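(* Let $\mu_1\le\mu_2\le\mu_3<0$ and put $\eta_i=\sqrt{|\mu_i|}>0$ for $i=1,2,3$. Suppose $u=(u_1,u_2,u_3)\in H^1(\mathbb{R})^3$ is a solution of $$u_i''+2(u_1^2+u_2^2+u_3^2)u_i=-\mu_iu_i\quad\text{in }\mathbb{R},\qquad i=1,2,3.$$ Then there exists a vector $(a_1,a_2,a_3)\in\mathbb{R}^3$ such that $$u_i(x)=\frac{g_i(x)}{f(x)},\qquad i=1,2,3,$$ where, for $i=1,2,3$, $$g_i(x)=a_ie^{\eta_ix}+\sum_{j=1}^{3}\frac{a_ia_j^2(\eta_i-\eta_j)}{4\eta_j^2(\eta_i+\eta_j)}e^{(2\eta_j+\eta_i)x}+\sum_{1\le j<k\le 3}\frac{a_ia_j^2a_k^2(\eta_j-\eta_k)^2(\eta_i-\eta_j)(\eta_i-\eta_k)}{16\eta_j^2\eta_k^2(\eta_j+\eta_k)^2(\eta_i+\eta_j)(\eta_i+\eta_k)}e^{(\eta_i+2\eta_j+2\eta_k)x},$$ and $$f(x)=1+\sum_{j=1}^{3}\frac{a_j^2}{4\eta_j^2}e^{2\eta_jx}+\sum_{1\le j<k\le 3}\frac{a_j^2a_k^2(\eta_j-\eta_k)^2}{16\eta_j^2\eta_k^2(\eta_j+\eta_k)^2}e^{2(\eta_j+\eta_k)x}+\frac{a_1^2a_2^2a_3^2(\eta_1-\eta_2)^2(\eta_1-\eta_3)^2(\eta_2-\eta_3)^2}{64\eta_1^2\eta_2^2\eta_3^2(\eta_1+\eta_2)^2(\eta_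1+\eta_3)^2(\eta_2+\eta_3)^2}e^{2(\eta_1+\eta_2+\eta_3)x}.$$
   Context: All functions are real-valued. *)

theory Defs
  imports "HOL-Analysis.Analysis"
begin

text \<open>Elements of \<open>H\<^sup>1(\<real>)\<close> are represented by Lebesgue measurable functions, any two of which
  represent the same element if they agree almost everywhere. All derivatives of such functions
  are taken in the weak (distributional) sense.\<close>

definition test_function :: "(real \<Rightarrow> real) \<Rightarrow> bool" where
  "test_function \<phi> \<longleftrightarrow>
     (\<forall>n. (deriv ^^ n) \<phi> differentiable_on UNIV) \<and> compact (closure {x. \<phi> x \<noteq> 0})"

definition locally_integrable :: "(real \<Rightarrow> real) \<Rightarrow> bool" where
  "locally_integrable v \<longleftrightarrow> (\<forall>K. compact K \<longrightarrow> v absolutely_integrable_on K)"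

definition has_weak_deriv :: "(real \<Rightarrow> real) \<Rightarrow> (real \<Rightarrow> real) \<Rightarrow> bool" where
  "has_weak_deriv v w \<longleftrightarrow> locally_integrable v \<and> locally_integrable w \<and>
     (\<forall>\<phi>. test_function \<phi> \<longrightarrow>
        (LINT x|lebesgue. v x * deriv \<phi> x) = - (LINT x|lebesgue. w x * \<phi> x))"

definition has_weak_second_deriv :: "(real \<Rightarrow> real) \<Rightarrow> (real \<Rightarrow> real) \<Rightarrow> bool" where
  "has_weak_second_deriv v w \<longleftrightarrow> (\<exists>v'. has_weak_deriv v v' \<and> has_weak_deriv v' w)"

definition L2_real :: "(real \<Rightarrow> real) set" where
  "L2_real = {v \<in> borel_measurable lebesgue. integrable lebesgue (\<lambda>x. (v x)\<^sup>2)}"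

definition H1_real :: "(real \<Rightarrow> real) set" where
  "H1_real = {v \<in> L2_real. \<exists>v' \<in> L2_real. has_weak_deriv v v'}"

text \<open>In the index type \<open>3\<close> one has \<open>3 = 0\<close>, hence \<open>3 < 1\<close> in the order of that type; the index
  pairs \<open>1 \<le> j < k \<le> 3\<close> are therefore listed explicitly.\<close>

definition index_pairs :: "(3 \<times> 3) set" where
  "index_pairs = {(1, 2), (1, 3), (2, 3)}"

definition soliton_num :: "real^3 \<Rightarrow> real^3 \<Rightarrow> 3 \<Rightarrow> real \<Rightarrow> real" where
  "soliton_num \<eta> a i x =
     a$i * exp (\<eta>$i * x)
   + (\<Sum>j\<in>UNIV. a$i * (a$j)\<^sup>2 * (\<eta>$i - \<eta>$j) / (4 * (\<eta>$j)\<^sup>2 * (\<eta>$i + \<eta>$j))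
        * exp ((2 * \<eta>$j + \<eta>$i) * x))
   + (\<Sum>(j, k)\<in>index_pairs.
        a$i * (a$j)\<^sup>2 * (a$k)\<^sup>2 * (\<eta>$j - \<eta>$k)\<^sup>2 * (\<eta>$i - \<eta>$j) * (\<eta>$i - \<eta>$k)
        / (16 * (\<eta>$j)\<^sup>2 * (\<eta>$k)\<^sup>2 * (\<eta>$j + \<eta>$k)\<^sup>2 * (\<eta>$i + \<eta>$j) * (\<eta>$i + \<eta>$k))
        * exp ((\<eta>$i + 2 * \<eta>$j + 2 * \<eta>$k) * x))"

definition soliton_den :: "real^3 \<Rightarrow> real^3 \<Rightarrow> real \<Rightarrow> real" where
  "soliton_den \<eta> a x =
     1
   + (\<Sum>j\<in>UNIV. (a$j)\<^sup>2 / (4 * (\<eta>$j)\<^sup>2) * exp (2 * \<eta>$j * x))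
   + (\<Sum>(j, k)\<in>index_pairs.
        (a$j)\<^sup>2 * (a$k)\<^sup>2 * (\<eta>$j - \<eta>$k)\<^sup>2
        / (16 * (\<eta>$j)\<^sup>2 * (\<eta>$k)\<^sup>2 * (\<eta>$j + \<eta>$k)\<^sup>2)
        * exp (2 * (\<eta>$j + \<eta>$k) * x))
   + (a$1)\<^sup>2 * (a$2)\<^sup>2 * (a$3)\<^sup>2 * (\<eta>$1 - \<eta>$2)\<^sup>2 * (\<eta>$1 - \<eta>$3)\<^sup>2 * (\<eta>$2 - \<eta>$3)\<^sup>2
     / (64 * (\<eta>$1)\<^sup>2 * (\<eta>$2)\<^sup>2 * (\<eta>$3)\<^sup>2 * (\<eta>$1 + \<eta>$2)\<^sup>2 * (\<eta>$1 + \<eta>$3)\<^sup>2 * (\<eta>$2 + \<eta>$3)\<^sup>2)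
     * exp (2 * (\<eta>$1 + \<eta>$2 + \<eta>$3) * x)"

end

theory Submission
  imports Defs
begin

text \<open>Write \<open>L\<close> for the diagonal matrix of the numbers \<open>\<eta>\<^sub>i\<close>, regard \<open>u\<close> as a column vector and put
  \<open>Q(x) = \<integral> u u\<^sup>T\<close>, the integral being taken over \<open>(-\<infinity>, x]\<close>. The solutions are explicit because \<open>Q\<close>
  linearises the equation \<open>u'' = L\<^sup>2 u - 2 |u|\<^sup>2 u\<close>.

  A solution that vanishes at \<open>-\<infinity>\<close> together with its derivative satisfies the first-order system
  \<open>u' = (L - Q) u\<close> and the algebraic relation \<open>L Q + Q L - Q\<^sup>2 = u u\<^sup>T\<close>. Indeed the defects
  \<open>r = u' - (L - Q) u\<close> and \<open>S = L Q + Q L - Q\<^sup>2 - u u\<^sup>T\<close> satisfy \<open>r' = - (L - Q) r + S u\<close> and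
  \<open>S' = - (r u\<^sup>T + u r\<^sup>T)\<close>, so that the energy \<open>|r|\<^sup>2 + |S|\<^sup>2 / 2\<close> has the derivative
  \<open>- 2 r \<bullet> (L - Q) r\<close>. Near \<open>-\<infinity>\<close> the matrix \<open>L - Q\<close> is positive definite, so there the energy is
  nonincreasing; it tends to 0 at \<open>-\<infinity>\<close> and hence vanishes there, and by Gronwall's inequality it
  vanishes everywhere. This is \<open>first_order_system\<close>.

  Let \<open>T = 2 L - Q\<close>. If \<open>u = T y\<close>, then the first-order system becomes \<open>y' = L y\<close>, that is,
  \<open>y\<^sub>i(x) = b\<^sub>i exp(\<eta>\<^sub>i x)\<close>, and the algebraic relation says that the inverse of \<open>T\<close> is the matrix \<open>W\<close>
  with the entries \<open>(\<delta>\<^sub>i\<^sub>j + y\<^sub>i y\<^sub>j) / (\<eta>\<^sub>i + \<eta>\<^sub>j)\<close>. Such a \<open>b\<close> is found at one point, where \<open>T\<close> is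
  invertible since \<open>Q\<close> is small, and uniqueness for linear differential equations propagates
  \<open>u = T y\<close> and \<open>T W = 1\<close> to the whole line (\<open>linear_soliton_system\<close>). So \<open>u\<close> is the solution of the
  linear system \<open>W u = y\<close> with explicit coefficients. For three components and \<open>a\<^sub>i = 2 \<eta>\<^sub>i b\<^sub>i\<close> the
  quotients \<open>g\<^sub>i / f\<close> solve the same system; this is an identity between rational functions of the
  \<open>\<eta>\<^sub>i\<close>, which comes down to the addition formula of the hyperbolic tangent (\<open>soliton_gram_system\<close>).

  The passage from weak to classical solutions rests on the fact that a function with a weak
  derivative is almost everywhere a primitive of that derivative (\<open>weak_deriv_difference\<close>). It is
  obtained by testing against smooth approximations of trapezoidal functions, and by
  Lebesgue's differentiation theorem as their flanks become steep. The right-hand side of the equation is then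
  continuous, so the second derivative is classical. Finally \<open>u\<close> tends to 0 at
  \<open>-\<infinity>\<close> because \<open>u\<close> and its weak derivative are square integrable, and then so does \<open>u'\<close> by the
  equation and the mean value theorem.\<close>


section \<open>Homogeneous linear differential equations\<close>

text \<open>The factor \<open>exp (- K t)\<close> turns the differential inequality into monotonicity.\<close>

lemma gronwall_nonpos:
  fixes E E' :: "real \<Rightarrow> real"
  assumes "a \<le> b" "E a \<le> 0"
    and deriv: "\<And>t. \<lbrakk>a \<le> t; t \<le> b\<rbrakk> \<Longrightarrow> (E has_real_derivative E' t) (at t)"
    and bound: "\<And>t. \<lbrakk>a \<le> t; t \<le> b\<rbrakk> \<Longrightarrow> E' t \<le> K * E t"
  shows "E b \<le> 0"
proof -
  have "E b * exp (- K * b) \<le> E a * exp (- K * a)"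
  proof (rule DERIV_nonpos_imp_nonincreasing[OF \<open>a \<le> b\<close>])
    fix t assume t: "a \<le> t" "t \<le> b"
    have "((\<lambda>t. E t * exp (- K * t)) has_real_derivative (E' t - K * E t) * exp (- K * t)) (at t)"
      by (rule derivative_eq_intros deriv[OF t] refl | simp add: algebra_simps)+
    moreover have "(E' t - K * E t) * exp (- K * t) \<le> 0"
      using bound[OF t] by (intro mult_nonpos_nonneg) auto
    ultimately show "\<exists>y. ((\<lambda>t. E t * exp (- K * t)) has_real_derivative y) (at t) \<and> y \<le> 0"
      by blast
  qed
  also have "\<dots> \<le> 0"
    using assms(2) by (intro mult_nonpos_nonneg) auto
  finally show ?thesis
    by (simp add: mult_le_0_iff)
qed

text \<open>The constant is far from optimal, but it tends to 0 with the entries of \<open>A\<close> and depends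
  continuously on them. This is what makes \<open>L - Q\<close> positive definite near \<open>-\<infinity>\<close> and what bounds the
  growth of energies on compact intervals.\<close>

lemma quadratic_form_bound:
  fixes A :: "'n::finite \<Rightarrow> 'n \<Rightarrow> real"
  shows "\<bar>\<Sum>i\<in>UNIV. \<Sum>j\<in>UNIV. A i j * v i * v j\<bar>
    \<le> (\<Sum>i\<in>UNIV. \<Sum>j\<in>UNIV. \<bar>A i j\<bar>) * (\<Sum>i\<in>UNIV. (v i)\<^sup>2)"
proof -
  have le: "\<bar>v i * v j\<bar> \<le> (\<Sum>k\<in>UNIV. (v k)\<^sup>2)" for i j
  proof -
    have "\<bar>v i * v j\<bar> \<le> (v i)\<^sup>2 \<or> \<bar>v i * v j\<bar> \<le> (v j)\<^sup>2"
      by (metis abs_mult abs_ge_zero abs_mult_self_eq linear mult_left_mono mult_right_mono power2_eq_square)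
    moreover have "(v k)\<^sup>2 \<le> (\<Sum>k\<in>UNIV. (v k)\<^sup>2)" for k
      by (rule member_le_sum) auto
    ultimately show ?thesis
      by (meson order_trans)
  qed
  have "\<bar>\<Sum>i\<in>UNIV. \<Sum>j\<in>UNIV. A i j * v i * v j\<bar> \<le> (\<Sum>i\<in>UNIV. \<Sum>j\<in>UNIV. \<bar>A i j * v i * v j\<bar>)"
    by (rule order_trans[OF sum_abs sum_mono[OF sum_abs]])
  also have "\<dots> \<le> (\<Sum>i\<in>UNIV. \<Sum>j\<in>UNIV. \<bar>A i j\<bar> * (\<Sum>k\<in>UNIV. (v k)\<^sup>2))"
    using le by (intro sum_mono) (simp add: abs_mult mult.assoc mult_left_mono)
  finally show ?thesis
    by (simp add: sum_distrib_right)
qed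

lemma linear_system_zero_forward:
  fixes A :: "real \<Rightarrow> 'n::finite \<Rightarrow> 'n \<Rightarrow> real" and z :: "'n \<Rightarrow> real \<Rightarrow> real"
  assumes cont: "\<And>i j. continuous_on UNIV (\<lambda>t. A t i j)"
    and deriv: "\<And>i t. (z i has_real_derivative (\<Sum>j\<in>UNIV. A t i j * z j t)) (at t)"
    and init: "\<And>i. z i a = 0" and "a \<le> b"
  shows "z i b = 0"
proof -
  define E where "E = (\<lambda>t. (\<Sum>i\<in>UNIV. (z i t)\<^sup>2))"
  define q where "q = (\<lambda>t. (\<Sum>i\<in>UNIV. \<Sum>j\<in>UNIV. \<bar>A t i j\<bar>))"
  have "continuous_on {a..b} q"
    unfolding q_def by (intro continuous_intros continuous_on_subset[OF cont]) auto
  then obtain m where m: "\<forall>t\<in>{a..b}. q t \<le> q m"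
    using continuous_attains_sup[of "{a..b}" q] \<open>a \<le> b\<close> by auto
  have "E b \<le> 0"
  proof (rule gronwall_nonpos[OF \<open>a \<le> b\<close>])
    show "E a \<le> 0"
      by (simp add: E_def init)
    fix t assume t: "a \<le> t" "t \<le> b"
    show "(E has_real_derivative 2 * (\<Sum>i\<in>UNIV. \<Sum>j\<in>UNIV. A t i j * z i t * z j t)) (at t)"
      unfolding E_def
      by (rule derivative_eq_intros deriv refl | simp add: sum_distrib_left mult_ac)+
    have "2 * (\<Sum>i\<in>UNIV. \<Sum>j\<in>UNIV. A t i j * z i t * z j t) \<le> 2 * (q t * E t)"
      using quadratic_form_bound[of "A t" "\<lambda>i. z i t"] by (simp add: q_def E_def)
    also have "\<dots> \<le> 2 * q m * E t"
      using bspec[OF m, of t] t by (simp add: E_def mult_right_mono sum_nonneg)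
    finally show "2 * (\<Sum>i\<in>UNIV. \<Sum>j\<in>UNIV. A t i j * z i t * z j t) \<le> 2 * q m * E t" .
  qed
  then have "(\<Sum>i\<in>UNIV. (z i b)\<^sup>2) = 0"
    by (simp add: E_def antisym sum_nonneg)
  then show ?thesis
    by (simp add: sum_nonneg_eq_0_iff)
qed

text \<open>Reflection in the origin reduces the values to the left of \<open>a\<close> to those on the right.\<close>

lemma linear_system_zero:
  fixes A :: "real \<Rightarrow> 'n::finite \<Rightarrow> 'n \<Rightarrow> real" and z :: "'n \<Rightarrow> real \<Rightarrow> real"
  assumes cont: "\<And>i j. continuous_on UNIV (\<lambda>t. A t i j)"
    and deriv: "\<And>i t. (z i has_real_derivative (\<Sum>j\<in>UNIV. A t i j * z j t)) (at t)"
    and init: "\<And>i. z i a = 0"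
  shows "z i b = 0"
proof (cases "a \<le> b")
  case True
  then show ?thesis
    using linear_system_zero_forward[OF cont deriv init] by blast
next
  case False
  have "(\<lambda>t. z i (- t)) (- b) = 0"
  proof (rule linear_system_zero_forward[where a = "- a" and A = "\<lambda>t i j. - A (- t) i j" and z = "\<lambda>i t. z i (- t)"])
    show "continuous_on UNIV (\<lambda>t. - A (- t) i j)" for i j
      by (intro continuous_intros continuous_on_compose2[OF cont]) auto
    show "((\<lambda>t. z i (- t)) has_real_derivative (\<Sum>j\<in>UNIV. - A (- t) i j * z j (- t))) (at t)" for i t
      using DERIV_chain2[where f = "z i" and g = uminus, OF deriv[of i "- t"] DERIV_minus[OF DERIV_ident]]
      by (simp add: sum_negf)
  qed (use init False in auto)
  then show ?thesis
    by simp
qed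

section \<open>Reduction to a first-order system\<close>

text \<open>The energy \<open>E = |r|\<^sup>2 + |S|\<^sup>2 / 2\<close> of the two defects is chosen such that the terms with \<open>S\<close>
  cancel in its derivative, which leaves the quadratic form of \<open>L - Q\<close> at \<open>r\<close>.\<close>

lemma first_order_system:
  fixes u u' :: "'n::finite \<Rightarrow> real \<Rightarrow> real" and Q :: "'n \<Rightarrow> 'n \<Rightarrow> real \<Rightarrow> real"
  assumes \<eta>: "\<And>i. \<eta> i > 0"
    and du: "\<And>i x. (u i has_real_derivative u' i x) (at x)"
    and du': "\<And>i x. (u' i has_real_derivative
                 (\<eta> i)\<^sup>2 * u i x - 2 * (\<Sum>k\<in>UNIV. (u k x)\<^sup>2) * u i x) (at x)"
    and dQ: "\<And>i j x. (Q i j has_real_derivative u i x * u j x) (at x)"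
    and Q_sym: "\<And>i j x. Q i j x = Q j i x"
    and lim_u: "\<And>i. (u i \<longlongrightarrow> 0) at_bot"
    and lim_u': "\<And>i. (u' i \<longlongrightarrow> 0) at_bot"
    and lim_Q: "\<And>i j. (Q i j \<longlongrightarrow> 0) at_bot"
  shows "u' i x = \<eta> i * u i x - (\<Sum>j\<in>UNIV. Q i j x * u j x)"
    and "(\<eta> i + \<eta> j) * Q i j x - (\<Sum>k\<in>UNIV. Q i k x * Q k j x) = u i x * u j x"
proof -
  define r where "r = (\<lambda>i x. u' i x - \<eta> i * u i x + (\<Sum>j\<in>UNIV. Q i j x * u j x))"
  define S where "S = (\<lambda>i j x. (\<eta> i + \<eta> j) * Q i j x - (\<Sum>k\<in>UNIV. Q i k x * Q k j x) - u i x * u j x)"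
  have u'_eq: "u' i x = r i x + \<eta> i * u i x - (\<Sum>j\<in>UNIV. Q i j x * u j x)" for i x
    by (simp add: r_def)
  have S_sym: "S i j x = S j i x" for i j x
  proof -
    have eq: "(\<Sum>k\<in>UNIV. Q i k x * Q k j x) = (\<Sum>k\<in>UNIV. Q j k x * Q k i x)"
      by (rule sum.cong) (simp_all add: Q_sym[of i] Q_sym[of _ j] mult.commute)
    show ?thesis
      unfolding S_def eq Q_sym[of i j x] by (simp add: algebra_simps)
  qed
  have dr: "(r i has_real_derivative
      - \<eta> i * r i x + (\<Sum>j\<in>UNIV. Q i j x * r j x) + (\<Sum>j\<in>UNIV. S i j x * u j x)) (at x)" for i x
  proof -
    have d: "(r i has_real_derivative
      ((\<eta> i)\<^sup>2 * u i x - 2 * (\<Sum>k\<in>UNIV. (u k x)\<^sup>2) * u i x) - \<eta> i * u' i x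
        + (\<Sum>j\<in>UNIV. u i x * u j x * u j x + Q i j x * u' j x)) (at x)"
      unfolding r_def
      by (rule derivative_eq_intros du du' dQ refl | simp add: algebra_simps)+
    have e1: "(\<Sum>j\<in>UNIV. u i x * u j x * u j x + Q i j x * u' j x)
      = (\<Sum>k\<in>UNIV. (u k x)\<^sup>2) * u i x + (\<Sum>j\<in>UNIV. Q i j x * r j x)
        + (\<Sum>j\<in>UNIV. \<eta> j * Q i j x * u j x)
        - (\<Sum>j\<in>UNIV. (\<Sum>k\<in>UNIV. Q i k x * Q k j x) * u j x)"
    proof -
      have "(\<Sum>j\<in>UNIV. (\<Sum>k\<in>UNIV. Q i k x * Q k j x) * u j x)
          = (\<Sum>k\<in>UNIV. Q i k x * (\<Sum>j\<in>UNIV. Q k j x * u j x))"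
        by (simp add: sum_distrib_left sum_distrib_right mult.assoc) (rule sum.swap)
      then show ?thesis
        unfolding u'_eq
        by (simp add: sum_distrib_left sum_distrib_right algebra_simps sum.distrib sum_subtractf power2_eq_square)
    qed
    have e2: "(\<Sum>j\<in>UNIV. S i j x * u j x)
      = \<eta> i * (\<Sum>j\<in>UNIV. Q i j x * u j x) + (\<Sum>j\<in>UNIV. \<eta> j * Q i j x * u j x)
        - (\<Sum>j\<in>UNIV. (\<Sum>k\<in>UNIV. Q i k x * Q k j x) * u j x) - (\<Sum>k\<in>UNIV. (u k x)\<^sup>2) * u i x"
      unfolding S_def
      by (simp add: sum_distrib_left sum_distrib_right algebra_simps sum.distrib sum_subtractf power2_eq_square)
    show ?thesis
      by (rule DERIV_cong[OF d], unfold e1 e2 u'_eq[of i x]) (simp add: algebra_simps power2_eq_square)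
  qed
  have dS: "(S i j has_real_derivative - (r i x * u j x + u i x * r j x)) (at x)" for i j x
  proof -
    have "(S i j has_real_derivative (\<eta> i + \<eta> j) * (u i x * u j x)
        - (\<Sum>k\<in>UNIV. u i x * u k x * Q k j x + Q i k x * (u k x * u j x))
        - (u' i x * u j x + u i x * u' j x)) (at x)"
      unfolding S_def
      by (rule derivative_eq_intros du du' dQ refl | simp add: algebra_simps)+
    moreover have "u' j x = r j x + \<eta> j * u j x - (\<Sum>k\<in>UNIV. Q k j x * u k x)"
      unfolding u'_eq by (simp add: Q_sym[of _ j])
    ultimately show ?thesis
      by (simp add: u'_eq[of i] algebra_simps sum.distrib sum_distrib_left sum_distrib_right)
  qed
  define E where "E = (\<lambda>x. (\<Sum>i\<in>UNIV. (r i x)\<^sup>2) + (\<Sum>i\<in>UNIV. \<Sum>j\<in>UNIV. (S i j x)\<^sup>2) / 2)"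
  define E' where "E' = (\<lambda>x. - 2 * (\<Sum>i\<in>UNIV. \<eta> i * (r i x)\<^sup>2)
      + 2 * (\<Sum>i\<in>UNIV. \<Sum>j\<in>UNIV. Q i j x * r i x * r j x))"
  have dE: "(E has_real_derivative E' x) (at x)" for x
  proof -
    have "(E has_real_derivative
        (\<Sum>i\<in>UNIV. 2 * r i x * (- \<eta> i * r i x + (\<Sum>j\<in>UNIV. Q i j x * r j x) + (\<Sum>j\<in>UNIV. S i j x * u j x)))
        + (\<Sum>i\<in>UNIV. \<Sum>j\<in>UNIV. 2 * S i j x * (- (r i x * u j x + u i x * r j x))) / 2) (at x)"
      unfolding E_def
      by (rule derivative_eq_intros dr dS refl | simp add: mult_ac)+
    moreover have swap: "(\<Sum>i\<in>UNIV. \<Sum>j\<in>UNIV. S i j x * (u i x * r j x))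
        = (\<Sum>i\<in>UNIV. \<Sum>j\<in>UNIV. S i j x * (r i x * u j x))"
      by (subst sum.swap) (simp add: S_sym mult.commute)
    moreover have "(\<Sum>i\<in>UNIV. \<Sum>j\<in>UNIV. 2 * S i j x * (- (r i x * u j x + u i x * r j x)))
        = - 2 * (\<Sum>i\<in>UNIV. \<Sum>j\<in>UNIV. S i j x * (r i x * u j x))
          - 2 * (\<Sum>i\<in>UNIV. \<Sum>j\<in>UNIV. S i j x * (u i x * r j x))"
      by (simp add: sum_distrib_left sum_negf sum_subtractf sum.distrib algebra_simps)
    moreover have "(\<Sum>i\<in>UNIV. 2 * r i x * (- \<eta> i * r i x + (\<Sum>j\<in>UNIV. Q i j x * r j x) + (\<Sum>j\<in>UNIV. S i j x * u j x)))
       = E' x + 2 * (\<Sum>i\<in>UNIV. \<Sum>j\<in>UNIV. S i j x * (r i x * u j x))"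
      unfolding E'_def
      by (simp add: algebra_simps sum.distrib sum_subtractf sum_negf sum_distrib_left power2_eq_square)
    ultimately show ?thesis
      by simp
  qed
  define q where "q = (\<lambda>x. (\<Sum>i\<in>UNIV. \<Sum>j\<in>UNIV. \<bar>Q i j x\<bar>))"
  define m where "m = Min (range \<eta>)"
  have m: "m > 0" "\<And>i. m \<le> \<eta> i"
    using \<eta> by (auto simp: m_def)
  \<comment> \<open>Near \<open>-\<infinity>\<close> one has \<open>q < m\<close>, so that the energy decreases; elsewhere \<open>2 q\<close> bounds its growth rate.\<close>
  have E'_le: "E' x \<le> 2 * (q x - m) * (\<Sum>i\<in>UNIV. (r i x)\<^sup>2)" for x
  proof -
    have "m * (\<Sum>i\<in>UNIV. (r i x)\<^sup>2) \<le> (\<Sum>i\<in>UNIV. \<eta> i * (r i x)\<^sup>2)"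
      unfolding sum_distrib_left by (intro sum_mono mult_right_mono m) auto
    then show ?thesis
      using quadratic_form_bound[of "\<lambda>i j. Q i j x" "\<lambda>i. r i x"]
      by (simp add: E'_def q_def algebra_simps)
  qed
  have r_le_E: "(\<Sum>i\<in>UNIV. (r i x)\<^sup>2) \<le> E x" and E_nonneg: "0 \<le> E x" for x
    by (auto simp: E_def intro!: sum_nonneg add_nonneg_nonneg)
  have lim_E: "(E \<longlongrightarrow> 0) at_bot"
    unfolding E_def r_def S_def
    by (rule tendsto_eq_intros lim_u lim_u' lim_Q refl | simp)+
  have lim_q: "(q \<longlongrightarrow> 0) at_bot"
    unfolding q_def by (rule tendsto_eq_intros lim_Q refl | simp)+
  obtain a where a: "\<And>t. t \<le> a \<Longrightarrow> q t < m"
    using order_tendstoD(2)[OF lim_q m(1)] by (auto simp: eventually_at_bot_linorder)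
  have E_le: "E x \<le> 0" if "x \<le> a" for x
  proof (rule tendsto_lowerbound[OF lim_E])
    show "\<forall>\<^sub>F s in at_bot. E x \<le> E s"
      unfolding eventually_at_bot_linorder
    proof (intro exI allI impI)
      fix s assume "s \<le> x"
      then show "E x \<le> E s"
      proof (rule DERIV_nonpos_imp_nonincreasing)
        fix t assume "s \<le> t" "t \<le> x"
        then have "q t < m"
          using a that by auto
        then have "2 * (q t - m) * (\<Sum>i\<in>UNIV. (r i t)\<^sup>2) \<le> 0"
          by (intro mult_nonpos_nonneg[of "2 * (q t - m)"] sum_nonneg) auto
        then have "E' t \<le> 0"
          using E'_le[of t] by linarith
        then show "\<exists>y. (E has_real_derivative y) (at t) \<and> y \<le> 0"
          using dE by blast
      qed
    qed
  qed simp
  have "E x = 0" for x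
  proof (cases "x \<le> a")
    case True
    then show ?thesis
      using E_le E_nonneg by (simp add: antisym)
  next
    case False
    have "continuous_on {a..x} q"
      unfolding q_def by (intro continuous_intros DERIV_continuous_on[OF DERIV_subset[OF dQ]]) auto
    then obtain s where s: "\<forall>t\<in>{a..x}. q t \<le> q s"
      using continuous_attains_sup[of "{a..x}" q] False by auto
    have "q s \<ge> 0"
      by (auto simp: q_def intro!: sum_nonneg)
    have "E x \<le> 0"
    proof (rule gronwall_nonpos[of a x E E' "2 * q s"])
      show "E a \<le> 0" using E_le by simp
      fix t assume t: "a \<le> t" "t \<le> x"
      have "E' t \<le> 2 * (q t - m) * (\<Sum>i\<in>UNIV. (r i t)\<^sup>2)"
        by (rule E'_le)
      also have "\<dots> \<le> 2 * q s * (\<Sum>i\<in>UNIV. (r i t)\<^sup>2)"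
        using bspec[OF s, of t] t m(1) by (intro mult_right_mono sum_nonneg) auto
      also have "\<dots> \<le> 2 * q s * E t"
        using r_le_E \<open>q s \<ge> 0\<close> by (intro mult_left_mono) auto
      finally show "E' t \<le> 2 * q s * E t" .
    qed (use False dE in auto)
    then show ?thesis
      using E_nonneg[of x] by simp
  qed
  then have E0: "(\<Sum>i\<in>UNIV. (r i x)\<^sup>2) + (\<Sum>i\<in>UNIV. \<Sum>j\<in>UNIV. (S i j x)\<^sup>2) / 2 = 0" for x
    by (simp add: E_def)
  have r2: "(\<Sum>i\<in>UNIV. (r i x)\<^sup>2) \<ge> 0" and S2: "(\<Sum>i\<in>UNIV. \<Sum>j\<in>UNIV. (S i j x)\<^sup>2) \<ge> 0" for x
    by (intro sum_nonneg zero_le_power2)+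
  have "(\<Sum>i\<in>UNIV. (r i x)\<^sup>2) = 0" "(\<Sum>i\<in>UNIV. \<Sum>j\<in>UNIV. (S i j x)\<^sup>2) = 0" for x
    using E0[of x] r2[of x] S2[of x] by linarith+
  then have zero: "r i x = 0" "S i j x = 0" for i j x
    by (simp_all add: sum_nonneg_eq_0_iff sum_nonneg)
  show "u' i x = \<eta> i * u i x - (\<Sum>j\<in>UNIV. Q i j x * u j x)"
    using zero(1)[of i x] by (simp add: r_def)
  show "(\<eta> i + \<eta> j) * Q i j x - (\<Sum>k\<in>UNIV. Q i k x * Q k j x) = u i x * u j x"
    using zero(2)[of i j x] by (simp add: S_def)
qed

section \<open>Linearisation\<close>

lemma sum_kronecker:
  fixes v c :: "'n::finite \<Rightarrow> real"
  shows "(\<Sum>j\<in>UNIV. (if i = j then c j else 0) * v j) = c i * v i"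
    and "(\<Sum>j\<in>UNIV. v j * (if j = i then c j else 0)) = v i * c i"
  by (simp_all add: if_distrib if_distribR cong: if_cong)

text \<open>The defects \<open>z = u - T y\<close> and \<open>Z = T W - 1\<close> satisfy \<open>z' = (L - Q) z\<close> and, once \<open>z = 0\<close> is known,
  \<open>Z' = - u y\<^sup>T Z\<close>. Both equations are linear and homogeneous, so it suffices to make \<open>z\<close> and \<open>Z\<close>
  vanish at a single point \<open>a\<close>. There \<open>T\<close> is invertible; \<open>b\<close> is chosen such that \<open>z(a) = 0\<close>, and
  \<open>Z(a) = 0\<close> follows on multiplying \<open>L T + T L - T\<^sup>2 = u u\<^sup>T\<close> from both sides by the inverse of \<open>T\<close>.\<close>

lemma linear_soliton_system:
  fixes u :: "'n::finite \<Rightarrow> real \<Rightarrow> real" and Q :: "'n \<Rightarrow> 'n \<Rightarrow> real \<Rightarrow> real"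
  assumes \<eta>: "\<And>i. \<eta> i > 0"
    and du: "\<And>i x. (u i has_real_derivative \<eta> i * u i x - (\<Sum>j\<in>UNIV. Q i j x * u j x)) (at x)"
    and dQ: "\<And>i j x. (Q i j has_real_derivative u i x * u j x) (at x)"
    and Q_sym: "\<And>i j x. Q i j x = Q j i x"
    and QQ: "\<And>i j x. (\<eta> i + \<eta> j) * Q i j x - (\<Sum>k\<in>UNIV. Q i k x * Q k j x) = u i x * u j x"
    and lim_Q: "\<And>i j. (Q i j \<longlongrightarrow> 0) at_bot"
  obtains b T where
    "\<And>i x. u i x = (\<Sum>j\<in>UNIV. T i j x * (b j * exp (\<eta> j * x)))"
    "\<And>i j x. (\<Sum>k\<in>UNIV. T i k x * ((if k = j then 1 else 0)
        + b k * exp (\<eta> k * x) * (b j * exp (\<eta> j * x))) / (\<eta> k + \<eta> j)) = (if i = j then 1 else 0)"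
proof -
  define T where "T = (\<lambda>i j x. (if i = j then 2 * \<eta> i else 0) - Q i j x)"
  have T_sym: "T i j x = T j i x" for i j x
    by (simp add: T_def Q_sym[of i j x])
  have T_mult: "(\<Sum>j\<in>UNIV. T i j x * v j) = 2 * \<eta> i * v i - (\<Sum>j\<in>UNIV. Q i j x * v j)" for i x v
    using sum_kronecker(1)[of i "\<lambda>_. 2 * \<eta> i" v] by (simp add: T_def left_diff_distrib sum_subtractf)
  have T_mult': "(\<Sum>j\<in>UNIV. v j * T j i x) = 2 * \<eta> i * v i - (\<Sum>j\<in>UNIV. v j * Q j i x)" for i x v
    using sum_kronecker(2)[of v i "\<lambda>j. 2 * \<eta> j"] by (simp add: T_def right_diff_distrib sum_subtractf)
  have TT: "(\<eta> i + \<eta> j) * T i j x - (\<Sum>k\<in>UNIV. T i k x * T k j x) = u i x * u j x" for i j x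
    unfolding T_mult T_mult' QQ[symmetric] by (simp add: T_def algebra_simps)
  have dT: "(T i j has_real_derivative - (u i x * u j x)) (at x)" for i j x
    unfolding T_def by (rule derivative_eq_intros dQ refl | simp)+

  define q where "q = (\<lambda>x. (\<Sum>i\<in>UNIV. \<Sum>j\<in>UNIV. \<bar>Q i j x\<bar>))"
  have lim_q: "(q \<longlongrightarrow> 0) at_bot"
    unfolding q_def by (rule tendsto_eq_intros lim_Q refl | simp)+
  define m where "m = Min (range \<eta>)"
  have m: "m > 0" "\<And>i. m \<le> \<eta> i"
    using \<eta> by (auto simp: m_def)
  \<comment> \<open>At such a point the quadratic form of \<open>T\<close> is positive definite.\<close>
  obtain a where "q a < m"
    using order_tendstoD(2)[OF lim_q m(1)] by (auto simp: eventually_at_bot_linorder)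
  define TM :: "real^'n^'n" where "TM = (\<chi> i j. T i j a)"
  have "v = 0" if "TM *v v = 0" for v :: "real^'n"
  proof -
    have "(\<Sum>j\<in>UNIV. T i j a * v$j) = 0" for i
      using that by (simp add: TM_def vec_eq_iff matrix_vector_mult_def)
    then have eq: "2 * \<eta> i * v$i = (\<Sum>j\<in>UNIV. Q i j a * v$j)" for i
      unfolding T_mult by simp
    have "2 * m * (\<Sum>i\<in>UNIV. (v$i)\<^sup>2) \<le> (\<Sum>i\<in>UNIV. 2 * \<eta> i * v$i * v$i)"
      unfolding sum_distrib_left
    proof (rule sum_mono)
      fix i show "2 * m * (v$i)\<^sup>2 \<le> 2 * \<eta> i * v$i * v$i"
        using mult_right_mono[OF m(2)[of i], of "(v$i)\<^sup>2"] by (simp add: power2_eq_square)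
    qed
    also have "\<dots> = (\<Sum>i\<in>UNIV. \<Sum>j\<in>UNIV. Q i j a * v$i * v$j)"
      unfolding eq by (simp add: sum_distrib_left sum_distrib_right mult_ac)
    also have "\<dots> \<le> q a * (\<Sum>i\<in>UNIV. (v$i)\<^sup>2)"
      using quadratic_form_bound[of "\<lambda>i j. Q i j a" "\<lambda>i. v$i"] by (simp add: q_def)
    finally have "(2 * m - q a) * (\<Sum>i\<in>UNIV. (v$i)\<^sup>2) \<le> 0"
      by (simp add: algebra_simps)
    moreover have "2 * m - q a > 0"
      using m(1) \<open>q a < m\<close> by simp
    ultimately have "(\<Sum>i\<in>UNIV. (v$i)\<^sup>2) \<le> 0"
      by (simp add: mult_le_0_iff)
    then have "(\<Sum>i\<in>UNIV. (v$i)\<^sup>2) = 0"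
      by (simp add: antisym sum_nonneg)
    then show "v = 0"
      by (simp add: sum_nonneg_eq_0_iff vec_eq_iff)
  qed
  then obtain X where XT: "X ** TM = mat 1"
    using matrix_left_invertible_ker[of TM] by auto
  then have TX: "TM ** X = mat 1"
    by (simp add: matrix_left_right_inverse)
  have "transpose TM = TM"
    by (simp add: TM_def transpose_def vec_eq_iff T_sym)
  then have "transpose X = X"
    by (metis TX XT matrix_mul_assoc matrix_mul_rid matrix_transpose_mul transpose_mat)
  then have X_sym: "X$i$j = X$j$i" for i j
    by (metis transpose_def vec_lambda_beta)
  have TX_entry: "(\<Sum>k\<in>UNIV. T i k a * X$k$j) = (if i = j then 1 else 0)" for i j
    using TX by (simp add: TM_def vec_eq_iff matrix_matrix_mult_def mat_def)
  have XT_entry: "(\<Sum>k\<in>UNIV. X$i$k * T k j a) = (if i = j then 1 else 0)" for i j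
    using XT by (simp add: TM_def vec_eq_iff matrix_matrix_mult_def mat_def)

  \<comment> \<open>The normalisation that gives \<open>y(a) = X u(a)\<close>.\<close>
  define b where "b i = (\<Sum>j\<in>UNIV. X$i$j * u j a) * exp (- \<eta> i * a)" for i
  define y where "y = (\<lambda>i x. b i * exp (\<eta> i * x))"
  define W where "W = (\<lambda>i j x. ((if i = j then 1 else 0) + y i x * y j x) / (\<eta> i + \<eta> j))"
  have dy: "(y i has_real_derivative \<eta> i * y i x) (at x)" for i x
    unfolding y_def by (rule derivative_eq_intros refl | simp)+
  have \<eta>_add: "\<eta> i + \<eta> j \<noteq> 0" for i j
    using \<eta>[of i] \<eta>[of j] by linarith
  have dW: "(W i j has_real_derivative y i x * y j x) (at x)" for i j x
  proof -
    have "((\<lambda>x. (if i = j then 1 else 0) + y i x * y j x) has_real_derivative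
        (\<eta> i + \<eta> j) * (y i x * y j x)) (at x)"
      by (rule DERIV_cong[OF DERIV_add[OF DERIV_const DERIV_mult[OF dy dy]]]) (simp add: algebra_simps)
    from DERIV_cdivide[OF this, of "\<eta> i + \<eta> j"] show ?thesis
      using \<eta>_add[of i j] by (simp add: W_def)
  qed
  have ya: "y i a = (\<Sum>j\<in>UNIV. X$i$j * u j a)" for i
    by (simp add: y_def b_def flip: exp_add)

  have z: "u i x - (\<Sum>j\<in>UNIV. T i j x * y j x) = 0" for i x
  proof (rule linear_system_zero[where a = a and z = "\<lambda>i x. u i x - (\<Sum>j\<in>UNIV. T i j x * y j x)"
        and A = "\<lambda>x i j. (if i = j then \<eta> i else 0) - Q i j x"])
    show "continuous_on UNIV (\<lambda>x. (if i = j then \<eta> i else 0) - Q i j x)" for i j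
      by (intro continuous_intros DERIV_continuous_on[OF dQ])
    have "(\<Sum>j\<in>UNIV. T i j a * y j a) = (\<Sum>l\<in>UNIV. (\<Sum>j\<in>UNIV. T i j a * X$j$l) * u l a)" for i
      unfolding ya by (simp add: sum_distrib_left sum_distrib_right mult.assoc) (rule sum.swap)
    then show "u i a - (\<Sum>j\<in>UNIV. T i j a * y j a) = 0" for i
      by (simp add: TX_entry if_distrib if_distribR cong: if_cong)
    fix i x
    have d: "((\<lambda>x. u i x - (\<Sum>j\<in>UNIV. T i j x * y j x)) has_real_derivative
        \<eta> i * u i x - (\<Sum>j\<in>UNIV. Q i j x * u j x)
        - (\<Sum>j\<in>UNIV. - (u i x * u j x) * y j x + T i j x * (\<eta> j * y j x))) (at x)"
      by (rule derivative_eq_intros du dT dy refl | simp add: algebra_simps)+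
    have comm: "T i j x * \<eta> j - \<eta> i * T i j x = \<eta> i * Q i j x - \<eta> j * Q i j x" for j
      by (simp add: T_def algebra_simps)
    have QT: "(\<Sum>k\<in>UNIV. Q i k x * T k j x) = u i x * u j x - T i j x * \<eta> j + \<eta> i * T i j x" for j
      unfolding T_mult' using QQ[of i j x] comm[of j] by (simp add: algebra_simps)
    have "(\<Sum>k\<in>UNIV. Q i k x * (\<Sum>j\<in>UNIV. T k j x * y j x))
        = (\<Sum>j\<in>UNIV. (\<Sum>k\<in>UNIV. Q i k x * T k j x) * y j x)"
      by (simp add: sum_distrib_left sum_distrib_right mult.assoc) (rule sum.swap)
    also have "\<dots> = (\<Sum>j\<in>UNIV. u i x * u j x * y j x) - (\<Sum>j\<in>UNIV. T i j x * (\<eta> j * y j x))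
        + \<eta> i * (\<Sum>j\<in>UNIV. T i j x * y j x)"
      unfolding QT by (simp add: algebra_simps sum.distrib sum_subtractf sum_distrib_left)
    finally have e: "(\<Sum>k\<in>UNIV. Q i k x * (\<Sum>j\<in>UNIV. T k j x * y j x)) = \<dots>" .
    have "(\<Sum>j\<in>UNIV. ((if i = j then \<eta> i else 0) - Q i j x) * (u j x - (\<Sum>k\<in>UNIV. T j k x * y k x)))
        = \<eta> i * (u i x - (\<Sum>k\<in>UNIV. T i k x * y k x)) - (\<Sum>j\<in>UNIV. Q i j x * u j x)
          + (\<Sum>j\<in>UNIV. Q i j x * (\<Sum>k\<in>UNIV. T j k x * y k x))"
      using sum_kronecker(1)[of i "\<lambda>_. \<eta> i" "\<lambda>j. u j x - (\<Sum>k\<in>UNIV. T j k x * y k x)"]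
      by (simp add: left_diff_distrib right_diff_distrib sum_subtractf)
    also have "\<dots> = \<eta> i * u i x - (\<Sum>j\<in>UNIV. Q i j x * u j x)
        - (\<Sum>j\<in>UNIV. - (u i x * u j x) * y j x + T i j x * (\<eta> j * y j x))"
      unfolding e by (simp add: sum.distrib sum_negf sum_subtractf algebra_simps)
    finally show "((\<lambda>x. u i x - (\<Sum>j\<in>UNIV. T i j x * y j x)) has_real_derivative
       (\<Sum>j\<in>UNIV. ((if i = j then \<eta> i else 0) - Q i j x) * (u j x - (\<Sum>k\<in>UNIV. T j k x * y k x)))) (at x)"
      using d by simp
  qed
  then have u_eq: "u i x = (\<Sum>j\<in>UNIV. T i j x * y j x)" for i x
    by (simp add: algebra_simps)

  have X_eq: "X$i$j = W i j a" for i j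
  proof -
    have "(\<Sum>k\<in>UNIV. X$i$k * (\<Sum>l\<in>UNIV. (u k a * u l a) * X$l$j)) = y i a * y j a"
      unfolding ya X_sym[of j] by (simp add: sum_distrib_left sum_distrib_right mult_ac)
    moreover have "(\<Sum>k\<in>UNIV. X$i$k * (\<Sum>l\<in>UNIV. (\<eta> k * T k l a) * X$l$j)) = \<eta> j * X$i$j"
    proof -
      have row: "(\<Sum>l\<in>UNIV. (\<eta> k * T k l a) * X$l$j) = \<eta> k * (if k = j then 1 else 0)" for k
        unfolding TX_entry[symmetric] by (simp add: sum_distrib_left mult_ac)
      show ?thesis
        unfolding row by (simp add: if_distrib if_distribR mult.commute cong: if_cong)
    qed
    moreover have "(\<Sum>k\<in>UNIV. X$i$k * (\<Sum>l\<in>UNIV. (\<eta> l * T k l a) * X$l$j)) = \<eta> i * X$i$j"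
    proof -
      have "(\<Sum>k\<in>UNIV. X$i$k * (\<Sum>l\<in>UNIV. (\<eta> l * T k l a) * X$l$j))
          = (\<Sum>l\<in>UNIV. (\<Sum>k\<in>UNIV. X$i$k * T k l a) * (\<eta> l * X$l$j))"
        by (simp add: sum_distrib_left sum_distrib_right mult_ac) (rule sum.swap)
      then show ?thesis
        by (simp add: XT_entry if_distrib if_distribR cong: if_cong)
    qed
    moreover have "(\<Sum>k\<in>UNIV. X$i$k * (\<Sum>l\<in>UNIV. (\<Sum>p\<in>UNIV. T k p a * T p l a) * X$l$j)) = (if i = j then 1 else 0)"
    proof -
      have "(\<Sum>l\<in>UNIV. (\<Sum>p\<in>UNIV. T k p a * T p l a) * X$l$j) = (\<Sum>p\<in>UNIV. T k p a * (\<Sum>l\<in>UNIV. T p l a * X$l$j))" for k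
        by (simp add: sum_distrib_left sum_distrib_right mult.assoc) (rule sum.swap)
      then show ?thesis
        by (simp add: TX_entry XT_entry if_distrib cong: if_cong)
    qed
    ultimately have "(\<eta> i + \<eta> j) * X$i$j - (if i = j then 1 else 0) = y i a * y j a"
      unfolding TT[symmetric]
      by (simp add: algebra_simps sum.distrib sum_subtractf)
    then have "X$i$j * (\<eta> i + \<eta> j) = (if i = j then 1 else 0) + y i a * y j a"
      by (simp add: algebra_simps)
    then show ?thesis
      unfolding W_def nonzero_eq_divide_eq[OF \<eta>_add] .
  qed

  have Z: "(\<Sum>k\<in>UNIV. T i k x * W k j x) - (if i = j then 1 else 0) = 0" for i j x
  proof (rule linear_system_zero[where a = a and A = "\<lambda>x i l. - u i x * y l x"
        and z = "\<lambda>i x. (\<Sum>k\<in>UNIV. T i k x * W k j x) - (if i = j then 1 else 0)"])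
    show "continuous_on UNIV (\<lambda>x. - u i x * y l x)" for i l
      by (intro continuous_intros DERIV_continuous_on[OF du] DERIV_continuous_on[OF dy])
    show "(\<Sum>k\<in>UNIV. T i k a * W k j a) - (if i = j then 1 else 0) = 0" for i
      using TX_entry[of i j] by (simp add: X_eq)
    fix i x
    have d: "((\<lambda>x. (\<Sum>k\<in>UNIV. T i k x * W k j x) - (if i = j then 1 else 0)) has_real_derivative
        (\<Sum>k\<in>UNIV. - (u i x * u k x) * W k j x + T i k x * (y k x * y j x))) (at x)"
      by (rule derivative_eq_intros dT dW refl | simp add: algebra_simps)+
    have "(\<Sum>k\<in>UNIV. u k x * W k j x) = (\<Sum>l\<in>UNIV. y l x * (\<Sum>k\<in>UNIV. T l k x * W k j x))"
    proof -
      have "(\<Sum>k\<in>UNIV. u k x * W k j x) = (\<Sum>k\<in>UNIV. \<Sum>l\<in>UNIV. y l x * (T l k x * W k j x))"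
      proof (rule sum.cong)
        fix k
        show "u k x * W k j x = (\<Sum>l\<in>UNIV. y l x * (T l k x * W k j x))"
          by (simp add: u_eq[of k] sum_distrib_left sum_distrib_right T_sym[of k] mult_ac)
      qed simp
      then show ?thesis
        unfolding sum_distrib_left by (rule trans[OF _ sum.swap])
    qed
    note uW = this
    have "(\<Sum>k\<in>UNIV. - (u i x * u k x) * W k j x + T i k x * (y k x * y j x))
       = - u i x * (\<Sum>k\<in>UNIV. u k x * W k j x) + (\<Sum>k\<in>UNIV. T i k x * y k x) * y j x"
      unfolding sum_distrib_left sum_distrib_right sum.distrib[symmetric]
      by (rule sum.cong) (simp_all add: algebra_simps)
    also have "\<dots> = - u i x * (\<Sum>l\<in>UNIV. y l x * (\<Sum>k\<in>UNIV. T l k x * W k j x)) + u i x * y j x"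
      unfolding uW by (simp only: u_eq[symmetric])
    also have "\<dots> = (\<Sum>l\<in>UNIV. - u i x * y l x * ((\<Sum>k\<in>UNIV. T l k x * W k j x) - (if l = j then 1 else 0)))"
      using sum_kronecker(2)[of "\<lambda>l. - u i x * y l x" j "\<lambda>_. 1"]
      unfolding right_diff_distrib[of "- u i x * y _ x"] sum_subtractf sum_distrib_left[of "- u i x"]
      by (simp only: mult.assoc)
    finally show "((\<lambda>x. (\<Sum>k\<in>UNIV. T i k x * W k j x) - (if i = j then 1 else 0)) has_real_derivative
      (\<Sum>l\<in>UNIV. - u i x * y l x * ((\<Sum>k\<in>UNIV. T l k x * W k j x) - (if l = j then 1 else 0)))) (at x)"
      by (rule DERIV_cong[OF d])
  qed
  show thesis
  proof (rule that[of T b])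
    show "u i x = (\<Sum>j\<in>UNIV. T i j x * (b j * exp (\<eta> j * x)))" for i x
      using u_eq[of i x] unfolding y_def .
    show "(\<Sum>k\<in>UNIV. T i k x * ((if k = j then 1 else 0)
        + b k * exp (\<eta> k * x) * (b j * exp (\<eta> j * x))) / (\<eta> k + \<eta> j)) = (if i = j then 1 else 0)" for i j x
      using Z[of i x j] unfolding y_def W_def by (simp only: times_divide_eq_right right_minus_eq)
  qed
qed

section \<open>The three-component soliton formula\<close>

text \<open>Putting \<open>\<eta>\<^sub>i = exp (2 \<theta>\<^sub>i)\<close> turns this quotient into \<open>tanh (\<theta>\<^sub>i - \<theta>\<^sub>j)\<close>.\<close>

definition scatter :: "real^3 \<Rightarrow> 3 \<Rightarrow> 3 \<Rightarrow> real" where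
  "scatter \<eta> i j = (\<eta>$i - \<eta>$j) / (\<eta>$i + \<eta>$j)"

text \<open>With \<open>a\<^sub>i = 2 \<eta>\<^sub>i b\<^sub>i\<close> the powers of 2 and of the \<open>\<eta>\<^sub>i\<close> cancel, and what remains is a polynomial in
  the squares \<open>Y\<^sub>j\<close> of the exponentials and in the numbers \<open>d\<^sub>j\<^sub>k\<close>.\<close>

lemma soliton_num_eq:
  fixes \<eta> b :: "real^3" and x :: real
  assumes \<eta>: "\<And>i. \<eta>$i > 0" and a: "\<And>i. a$i = 2 * \<eta>$i * b$i"
  defines "Y \<equiv> \<lambda>i. (b$i * exp (\<eta>$i * x))\<^sup>2" and "d \<equiv> scatter \<eta>"
  shows "soliton_num \<eta> a i x = 2 * \<eta>$i * (b$i * exp (\<eta>$i * x)) *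
    (1 + (\<Sum>j\<in>UNIV. d i j * Y j) + (\<Sum>(j, k)\<in>index_pairs. (d j k)\<^sup>2 * d i j * d i k * Y j * Y k))"
proof -
  have s: "a$i * (a$j)\<^sup>2 * (\<eta>$i - \<eta>$j) / (4 * (\<eta>$j)\<^sup>2 * (\<eta>$i + \<eta>$j)) * exp ((2 * \<eta>$j + \<eta>$i) * x)
      = 2 * \<eta>$i * (b$i * exp (\<eta>$i * x)) * (d i j * Y j)" for j
  proof -
    have e: "exp ((2 * \<eta>$j + \<eta>$i) * x) = exp (\<eta>$i * x) * (exp (\<eta>$j * x))\<^sup>2"
      by (simp add: power2_eq_square algebra_simps flip: exp_add)
    show ?thesis
      using \<eta>[of i] \<eta>[of j] unfolding e a Y_def d_def scatter_def
      by (simp add: divide_simps power2_eq_square)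
  qed
  have p: "a$i * (a$j)\<^sup>2 * (a$k)\<^sup>2 * (\<eta>$j - \<eta>$k)\<^sup>2 * (\<eta>$i - \<eta>$j) * (\<eta>$i - \<eta>$k)
        / (16 * (\<eta>$j)\<^sup>2 * (\<eta>$k)\<^sup>2 * (\<eta>$j + \<eta>$k)\<^sup>2 * (\<eta>$i + \<eta>$j) * (\<eta>$i + \<eta>$k))
        * exp ((\<eta>$i + 2 * \<eta>$j + 2 * \<eta>$k) * x)
      = 2 * \<eta>$i * (b$i * exp (\<eta>$i * x)) * ((d j k)\<^sup>2 * d i j * d i k * Y j * Y k)" for j k
  proof -
    have e: "exp ((\<eta>$i + 2 * \<eta>$j + 2 * \<eta>$k) * x) = exp (\<eta>$i * x) * (exp (\<eta>$j * x))\<^sup>2 * (exp (\<eta>$k * x))\<^sup>2"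
      by (simp add: power2_eq_square algebra_simps flip: exp_add)
    show ?thesis
      using \<eta>[of i] \<eta>[of j] \<eta>[of k] unfolding e a Y_def d_def scatter_def
      by (simp add: power_mult_distrib power_divide mult_ac)
  qed
  show ?thesis
    unfolding soliton_num_def s p
    by (simp add: a distrib_left sum_distrib_left index_pairs_def)
qed

lemma soliton_den_eq:
  fixes \<eta> b :: "real^3" and x :: real
  assumes \<eta>: "\<And>i. \<eta>$i > 0" and a: "\<And>i. a$i = 2 * \<eta>$i * b$i"
  defines "Y \<equiv> \<lambda>i. (b$i * exp (\<eta>$i * x))\<^sup>2" and "d \<equiv> scatter \<eta>"
  shows "soliton_den \<eta> a x = 1 + (\<Sum>j\<in>UNIV. Y j) + (\<Sum>(j, k)\<in>index_pairs. (d j k)\<^sup>2 * Y j * Y k)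
    + (d 1 2)\<^sup>2 * (d 1 3)\<^sup>2 * (d 2 3)\<^sup>2 * Y 1 * Y 2 * Y 3"
proof -
  have e: "exp (2 * \<eta>$j * x) = (exp (\<eta>$j * x))\<^sup>2" 
     "exp (2 * (\<eta>$j + \<eta>$k) * x) = (exp (\<eta>$j * x))\<^sup>2 * (exp (\<eta>$k * x))\<^sup>2"
     "exp (2 * (\<eta>$1 + \<eta>$2 + \<eta>$3) * x) = (exp (\<eta>$1 * x))\<^sup>2 * (exp (\<eta>$2 * x))\<^sup>2 * (exp (\<eta>$3 * x))\<^sup>2" for j k
    by (simp_all add: power2_eq_square algebra_simps flip: exp_add)
  have nz: "\<eta>$i \<noteq> 0" for i
    using \<eta>[of i] by simp
  have "(a$j)\<^sup>2 / (4 * (\<eta>$j)\<^sup>2) * exp (2 * \<eta>$j * x) = Y j" for j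
    using nz unfolding e a by (simp add: Y_def power_mult_distrib)
  moreover have "(a$j)\<^sup>2 * (a$k)\<^sup>2 * (\<eta>$j - \<eta>$k)\<^sup>2 / (16 * (\<eta>$j)\<^sup>2 * (\<eta>$k)\<^sup>2 * (\<eta>$j + \<eta>$k)\<^sup>2)
        * exp (2 * (\<eta>$j + \<eta>$k) * x) = (d j k)\<^sup>2 * Y j * Y k" for j k
    using nz unfolding e a by (simp add: Y_def d_def scatter_def power_mult_distrib power_divide mult_ac)
  moreover have "(a$1)\<^sup>2 * (a$2)\<^sup>2 * (a$3)\<^sup>2 * (\<eta>$1 - \<eta>$2)\<^sup>2 * (\<eta>$1 - \<eta>$3)\<^sup>2 * (\<eta>$2 - \<eta>$3)\<^sup>2
     / (64 * (\<eta>$1)\<^sup>2 * (\<eta>$2)\<^sup>2 * (\<eta>$3)\<^sup>2 * (\<eta>$1 + \<eta>$2)\<^sup>2 * (\<eta>$1 + \<eta>$3)\<^sup>2 * (\<eta>$2 + \<eta>$3)\<^sup>2)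
     * exp (2 * (\<eta>$1 + \<eta>$2 + \<eta>$3) * x) = (d 1 2)\<^sup>2 * (d 1 3)\<^sup>2 * (d 2 3)\<^sup>2 * Y 1 * Y 2 * Y 3"
    using nz unfolding e a by (simp add: Y_def d_def scatter_def power_mult_distrib power_divide mult_ac)
  ultimately show ?thesis
    unfolding soliton_den_def by simp
qed

lemma scatter_refl [simp]: "scatter \<eta> i i = 0"
  and scatter_swap: "scatter \<eta> i j = - scatter \<eta> j i"
  by (simp_all add: scatter_def add.commute minus_divide_left)


text \<open>The addition formula \<open>tanh (p + q) (1 + tanh p tanh q) = tanh p + tanh q\<close>.\<close>

lemma scatter_addition:
  assumes "\<And>i. \<eta>$i > 0"
  shows "scatter \<eta> i k * (1 + scatter \<eta> i j * scatter \<eta> j k) = scatter \<eta> i j + scatter \<eta> j k"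
proof -
  have "\<eta>$j + \<eta>$k \<noteq> 0" "\<eta>$i + \<eta>$j \<noteq> 0" "\<eta>$i + \<eta>$k \<noteq> 0"
    using assms[of i] assms[of j] assms[of k] by linarith+
  then show ?thesis
    unfolding scatter_def
    by (simp add: divide_simps) (simp add: algebra_simps)
qed

lemma eq_by_diff:
  fixes A B c R :: real
  assumes "R = 0" "A = B + c * R"
  shows "A = B"
  using assms by simp

text \<open>Since \<open>2 \<eta>\<^sub>j / (\<eta>\<^sub>i + \<eta>\<^sub>j) = 1 - d\<^sub>i\<^sub>j\<close>, the system says \<open>h\<^sub>i + \<Sum>\<^sub>j (1 - d\<^sub>i\<^sub>j) Y\<^sub>j h\<^sub>j = f\<close>
  when \<open>g\<^sub>j = 2 \<eta>\<^sub>j y\<^sub>j h\<^sub>j\<close>. Comparing coefficients of the monomials in \<open>Y\<^sub>1, Y\<^sub>2, Y\<^sub>3\<close>, one needs the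
  relation between \<open>d\<^sub>1\<^sub>2\<close>, \<open>d\<^sub>2\<^sub>3\<close> and \<open>d\<^sub>1\<^sub>3\<close> for two of them only: the product of
  the two \<open>Y\<^sub>j\<close> with \<open>j \<noteq> i\<close>, and the product of all three.\<close>

lemma soliton_gram_system:
  fixes \<eta> b :: "real^3" and x :: real
  assumes \<eta>: "\<And>i. \<eta>$i > 0" and a: "\<And>i. a$i = 2 * \<eta>$i * b$i"
  defines "y \<equiv> \<lambda>i. b$i * exp (\<eta>$i * x)"
  shows "(\<Sum>j\<in>UNIV. ((if i = j then 1 else 0) + y i * y j) / (\<eta>$i + \<eta>$j) * soliton_num \<eta> a j x)
    = y i * soliton_den \<eta> a x"
proof -
  define Y where "Y i = (y i)\<^sup>2" for i
  define h where "h i = 1 + (\<Sum>j\<in>UNIV. scatter \<eta> i j * Y j)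
    + (\<Sum>(j, k)\<in>index_pairs. (scatter \<eta> j k)\<^sup>2 * scatter \<eta> i j * scatter \<eta> i k * Y j * Y k)" for i
  have num: "soliton_num \<eta> a j x = 2 * \<eta>$j * y j * h j" for j
    using soliton_num_eq[OF \<eta> a] by (simp add: y_def Y_def h_def)
  have "((if i = j then 1 else 0) + y i * y j) / (\<eta>$i + \<eta>$j) * soliton_num \<eta> a j x
      = (if i = j then y j * h j else 0) + y i * ((1 - scatter \<eta> i j) * Y j * h j)" for j
    using \<eta>[of i] \<eta>[of j] unfolding num scatter_def Y_def
    by (simp add: divide_simps power2_eq_square) (simp add: algebra_simps)
  then have "(\<Sum>j\<in>UNIV. ((if i = j then 1 else 0) + y i * y j) / (\<eta>$i + \<eta>$j) * soliton_num \<eta> a j x)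
      = y i * (h i + (\<Sum>j\<in>UNIV. (1 - scatter \<eta> i j) * Y j * h j))"
    by (simp add: sum.distrib sum_distrib_left distrib_left)
  also have "h i + (\<Sum>j\<in>UNIV. (1 - scatter \<eta> i j) * Y j * h j) = soliton_den \<eta> a x"
  proof -
    define p where "p = scatter \<eta> 1 2"
    define q where "q = scatter \<eta> 2 3"
    define r where "r = scatter \<eta> 1 3"
    have d: "scatter \<eta> 1 2 = p" "scatter \<eta> 2 3 = q" "scatter \<eta> 1 3 = r"
       "scatter \<eta> 2 1 = - p" "scatter \<eta> 3 2 = - q" "scatter \<eta> 3 1 = - r"
      by (simp_all add: p_def q_def r_def scatter_swap[of \<eta> 2 1] scatter_swap[of \<eta> 3 2] scatter_swap[of \<eta> 3 1])
    \<comment> \<open>The addition formula, in the form in which it enters the three cases.\<close>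
    define R where "R = p * q * r + r - p - q"
    have R: "R = 0"
      using scatter_addition[OF \<eta>, of 1 3 2] by (simp add: R_def p_def q_def r_def algebra_simps)
    have den: "soliton_den \<eta> a x = 1 + (Y 1 + Y 2 + Y 3) + (p\<^sup>2 * Y 1 * Y 2 + r\<^sup>2 * Y 1 * Y 3 + q\<^sup>2 * Y 2 * Y 3)
        + p\<^sup>2 * r\<^sup>2 * q\<^sup>2 * Y 1 * Y 2 * Y 3"
      using soliton_den_eq[OF \<eta> a] by (simp add: Y_def y_def index_pairs_def sum_3 d)
    have h: "h 1 = 1 + (p * Y 2 + r * Y 3) + q\<^sup>2 * p * r * Y 2 * Y 3"
      "h 2 = 1 + (- p * Y 1 + q * Y 3) + r\<^sup>2 * (- p) * q * Y 1 * Y 3"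
      "h 3 = 1 + (- r * Y 1 - q * Y 2) + p\<^sup>2 * (- r) * (- q) * Y 1 * Y 2"
      by (simp_all add: h_def index_pairs_def sum_3 d)
    consider "i = 1" | "i = 2" | "i = 3"
      using exhaust_3[of i] by auto
    then show ?thesis
    proof cases
      case 1
      show ?thesis
        unfolding den
        by (rule eq_by_diff[where c = "q * Y 2 * Y 3 - p * q * r * Y 1 * Y 2 * Y 3", OF R])
          (simp add: 1 R_def sum_3 h d algebra_simps power2_eq_square)
    next
      case 2
      show ?thesis
        unfolding den
        by (rule eq_by_diff[where c = "- r * Y 1 * Y 3 - p * q * r * Y 1 * Y 2 * Y 3", OF R])
          (simp add: 2 R_def sum_3 h d algebra_simps power2_eq_square)
    next
      case 3
      show ?thesis
        unfolding den
        by (rule eq_by_diff[where c = "p * Y 1 * Y 2 - p * q * r * Y 1 * Y 2 * Y 3", OF R])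
          (simp add: 3 R_def sum_3 h d algebra_simps power2_eq_square)
    qed
  qed
  finally show ?thesis .
qed

lemma soliton_den_pos:
  assumes "\<And>i. \<eta>$i > 0"
  shows "soliton_den \<eta> a x > 0"
  unfolding soliton_den_def
  by (intro add_pos_nonneg sum_nonneg mult_nonneg_nonneg divide_nonneg_nonneg zero_le_power2 exp_ge_zero)
     (auto intro!: mult_nonneg_nonneg divide_nonneg_nonneg)

section \<open>Smooth cut-off functions\<close>

text \<open>Recursion through \<open>deriv\<close> makes the closure properties below simple inductions.\<close>

fun smooth_upto :: "nat \<Rightarrow> (real \<Rightarrow> real) \<Rightarrow> bool" where
  "smooth_upto 0 f \<longleftrightarrow> f differentiable_on UNIV"
| "smooth_upto (Suc n) f \<longleftrightarrow> f differentiable_on UNIV \<and> smooth_upto n (deriv f)"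

lemma smooth_upto_iff: "smooth_upto n f \<longleftrightarrow> (\<forall>m\<le>n. (deriv ^^ m) f differentiable_on UNIV)"
proof (induction n arbitrary: f)
  case (Suc n)
  have "(\<forall>m\<le>Suc n. (deriv ^^ m) f differentiable_on UNIV) \<longleftrightarrow>
      f differentiable_on UNIV \<and> (\<forall>m\<le>n. (deriv ^^ Suc m) f differentiable_on UNIV)"
    by (metis Suc_le_mono le0 not0_implies_Suc funpow_0)
  then show ?case
    by (simp add: Suc funpow_Suc_right del: funpow.simps)
qed simp

lemma smooth_upto_differentiable: "smooth_upto n f \<Longrightarrow> f differentiable_on UNIV"
  by (cases n) auto

lemma smooth_upto_SucD: "smooth_upto (Suc n) f \<Longrightarrow> smooth_upto n f"
  by (simp add: smooth_upto_iff)

lemma differentiable_on_UNIV_deriv: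
  "f differentiable_on UNIV \<Longrightarrow> (f has_real_derivative deriv f x) (at x)" for f :: "real \<Rightarrow> real"
  by (simp add: differentiable_on_def real_differentiable_def DERIV_deriv_iff_real_differentiable)

lemma smooth_upto_SucI:
  assumes "\<And>x. (f has_real_derivative f' x) (at x)" "smooth_upto n f'"
  shows "smooth_upto (Suc n) f"
proof -
  have "deriv f = f'"
    using assms(1) DERIV_imp_deriv by blast
  then show ?thesis
    using assms by (auto simp: differentiable_on_def real_differentiable_def)
qed

lemma smooth_upto_add: "smooth_upto n f \<Longrightarrow> smooth_upto n g \<Longrightarrow> smooth_upto n (\<lambda>x. f x + g x)"
proof (induction n arbitrary: f g)
  case (Suc n)
  then have f: "f differentiable_on UNIV" and g: "g differentiable_on UNIV"
    by auto
  show ?case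
  proof (rule smooth_upto_SucI)
    show "((\<lambda>x. f x + g x) has_real_derivative deriv f x + deriv g x) (at x)" for x
      by (intro DERIV_add differentiable_on_UNIV_deriv f g)
    show "smooth_upto n (\<lambda>x. deriv f x + deriv g x)"
      using Suc by auto
  qed
qed (auto intro: differentiable_on_add)

text \<open>The order of differentiability drops by one in both factors of each term of the product rule,
  so the induction has to range over all pairs of functions.\<close>

lemma smooth_upto_mult: "smooth_upto n f \<Longrightarrow> smooth_upto n g \<Longrightarrow> smooth_upto n (\<lambda>x. f x * g x)"
proof (induction n arbitrary: f g)
  case (Suc n)
  then have f: "f differentiable_on UNIV" and g: "g differentiable_on UNIV"
    by auto
  show ?case
  proof (rule smooth_upto_SucI)
    show "((\<lambda>x. f x * g x) has_real_derivative deriv f x * g x + deriv g x * f x) (at x)" for x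
      by (intro DERIV_mult differentiable_on_UNIV_deriv f g)
    show "smooth_upto n (\<lambda>x. deriv f x * g x + deriv g x * f x)"
      using Suc.prems smooth_upto_SucD[OF Suc.prems(1)] smooth_upto_SucD[OF Suc.prems(2)]
      by (intro smooth_upto_add Suc.IH) auto
  qed
qed (auto intro: differentiable_on_mult)

lemma smooth_upto_const: "smooth_upto n (\<lambda>x. c)"
  by (induction n arbitrary: c) (auto simp: differentiable_on_const)

lemma smooth_upto_affine: "smooth_upto n f \<Longrightarrow> smooth_upto n (\<lambda>x. f (k * x + c))"
proof (induction n arbitrary: f)
  case 0
  then have "((\<lambda>x. f (k * x + c)) has_real_derivative deriv f (k * x + c) * k) (at x)" for x
    by (intro DERIV_chain2[OF differentiable_on_UNIV_deriv]) (auto intro!: derivative_eq_intros)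
  then show ?case
    by (auto simp: differentiable_on_def real_differentiable_def)
next
  case (Suc n)
  then have f: "f differentiable_on UNIV"
    by simp
  show ?case
  proof (rule smooth_upto_SucI)
    show "((\<lambda>x. f (k * x + c)) has_real_derivative deriv f (k * x + c) * k) (at x)" for x
      by (rule DERIV_chain2[OF differentiable_on_UNIV_deriv[OF f]]) (auto intro!: derivative_eq_intros)
    show "smooth_upto n (\<lambda>x. deriv f (k * x + c) * k)"
      using Suc by (intro smooth_upto_mult smooth_upto_const) auto
  qed
qed

text \<open>The polynomial factor makes the family closed under differentiation.\<close>

definition exp_cutoff :: "real poly \<Rightarrow> real \<Rightarrow> real" where
  "exp_cutoff p x = (if x > 0 then poly p (1 / x) * exp (- 1 / x) else 0)"

lemma tendsto_poly_exp_0: "((\<lambda>t. poly p t * exp (- t)) \<longlongrightarrow> 0) at_top" for p :: "real poly"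
proof -
  have "((\<lambda>t. \<Sum>i\<le>degree p. coeff p i * (t ^ i / exp t)) \<longlongrightarrow> 0) at_top"
    by (rule tendsto_null_sum) (intro tendsto_mult_right_zero tendsto_power_div_exp_0)
  then show ?thesis
    by (simp add: poly_altdef exp_minus divide_inverse sum_distrib_right mult.assoc)
qed

text \<open>At the origin the difference quotient is again a polynomial in \<open>1 / x\<close> times \<open>exp (- 1 / x)\<close>,
  and the exponential wins.\<close>

lemma exp_cutoff_deriv:
  "(exp_cutoff p has_real_derivative exp_cutoff ((p - pderiv p) * monom 1 2) x) (at x)"
proof (cases "x > 0")
  case True
  have "((\<lambda>x. poly p (1 / x) * exp (- 1 / x)) has_real_derivative
      poly (pderiv p) (1 / x) * (- 1 / x\<^sup>2) * exp (- 1 / x) + poly p (1 / x) * (exp (- 1 / x) * (1 / x\<^sup>2))) (at x)"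
    using True by (auto intro!: derivative_eq_intros DERIV_chain2[OF poly_DERIV] simp: power2_eq_square field_simps)
  then have "((\<lambda>x. poly p (1 / x) * exp (- 1 / x)) has_real_derivative exp_cutoff ((p - pderiv p) * monom 1 2) x) (at x)"
    by (rule DERIV_cong) (use True in \<open>simp add: exp_cutoff_def poly_monom field_simps power2_eq_square\<close>)
  then show ?thesis
    by (rule has_field_derivative_transform_within_open[of _ _ _ "{0<..}"])
       (use True in \<open>auto simp: exp_cutoff_def\<close>)
next
  case False
  show ?thesis
  proof (cases "x = 0")
    case True
    \<comment> \<open>Substitute \<open>t = 1 / y\<close>; the quotient by \<open>y\<close> raises the degree of the polynomial by one.\<close>
    have "((\<lambda>y. exp_cutoff p y / y) \<longlongrightarrow> 0) (at_right 0)"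
    proof -
      have "((\<lambda>t. poly (pCons 0 p) t * exp (- t)) \<longlongrightarrow> 0) at_top"
        by (rule tendsto_poly_exp_0)
      from filterlim_compose[OF this filterlim_inverse_at_top_right]
      have "((\<lambda>y. poly (pCons 0 p) (inverse y) * exp (- inverse y)) \<longlongrightarrow> 0) (at_right 0)" .
      moreover have "\<forall>\<^sub>F y in at_right 0. poly (pCons 0 p) (inverse y) * exp (- inverse y) = exp_cutoff p y / y"
        by (rule eventually_at_rightI[of 0 1]) (auto simp: exp_cutoff_def field_simps)
      ultimately show ?thesis
        by (rule Lim_transform_eventually)
    qed
    moreover have "((\<lambda>y. exp_cutoff p y / y) \<longlongrightarrow> 0) (at_left 0)"
      by (rule tendsto_eventually) (auto simp: exp_cutoff_def eventually_at_left_field intro!: exI[of _ "-1"])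
    ultimately have "((\<lambda>y. exp_cutoff p y / y) \<longlongrightarrow> 0) (at 0)"
      by (simp add: filterlim_split_at)
    then show ?thesis
      using True by (simp add: DERIV_def exp_cutoff_def)
  next
    case neq: False
    have "((\<lambda>_. 0) has_real_derivative 0) (at x)"
      by simp
    then have "(exp_cutoff p has_real_derivative 0) (at x)"
      by (rule has_field_derivative_transform_within_open[of _ _ _ "{..<0}"])
         (use neq False in \<open>auto simp: exp_cutoff_def\<close>)
    then show ?thesis
      using neq False by (simp add: exp_cutoff_def)
  qed
qed

lemma exp_cutoff_smooth: "smooth_upto n (exp_cutoff p)"
proof (induction n arbitrary: p)
  case 0
  then show ?case
    using exp_cutoff_deriv by (auto simp: differentiable_on_def real_differentiable_def)
next
  case (Suc n)
  then show ?case
    using smooth_upto_SucI[OF exp_cutoff_deriv] by blast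
qed

definition bump :: "real \<Rightarrow> real \<Rightarrow> real \<Rightarrow> real" where
  "bump h k x = exp_cutoff 1 (k * x) * exp_cutoff 1 (k * (h - x))"

lemma bump_smooth: "smooth_upto n (bump h k)"
  using smooth_upto_mult[OF smooth_upto_affine[OF exp_cutoff_smooth, where k = k and c = 0]
       smooth_upto_affine[OF exp_cutoff_smooth, where k = "- k" and c = "k * h"], of n 1 1]
  by (simp add: bump_def[abs_def] algebra_simps)

lemma bump_bounds: "0 \<le> bump h k x" "bump h k x \<le> 1"
  by (auto simp: bump_def exp_cutoff_def mult_le_one)

lemma bump_eq_0: "k > 0 \<Longrightarrow> x \<notin> {0<..<h} \<Longrightarrow> bump h k x = 0"
  by (auto simp: bump_def exp_cutoff_def zero_less_mult_iff)

text \<open>Inside the interval both factors have the form \<open>exp (- 1 / (k t))\<close> with fixed \<open>t > 0\<close>, and outside one of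
  them is 0.\<close>

lemma bump_tendsto: "(\<lambda>n. bump h (real (Suc n)) x) \<longlonglongrightarrow> indicator {0<..<h} x"
proof (cases "x \<in> {0<..<h}")
  case True
  have "(\<lambda>n. exp (- (1 / x) * inverse (real (Suc n)))) \<longlonglongrightarrow> exp (- (1 / x) * 0)" for x :: real
    by (intro tendsto_intros LIMSEQ_inverse_real_of_nat)
  then have "(\<lambda>n. exp_cutoff 1 (real (Suc n) * x)) \<longlonglongrightarrow> 1" if "x > 0" for x
    using that by (simp add: exp_cutoff_def divide_simps mult.commute)
  from tendsto_mult[OF this[of x] this[of "h - x"]] True show ?thesis
    by (simp add: bump_def)
next
  case False
  then show ?thesis
    by (simp add: bump_eq_0)
qed

section \<open>Weak derivatives and primitives\<close>

lemma borel_measurable_lebesgue_continuous: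
  "continuous_on UNIV f \<Longrightarrow> f \<in> borel_measurable lebesgue" for f :: "real \<Rightarrow> real"
  by (intro measurable_completion) (simp add: borel_measurable_continuous_onI)

lemma bump_continuous: "continuous_on S (bump h k)"
  using smooth_upto_differentiable[OF bump_smooth, of h k]
  by (meson continuous_on_subset differentiable_imp_continuous_on subset_UNIV)

text \<open>As a function of \<open>x\<close> this is a primitive of \<open>bump h k (x - a) - bump h k (x - c)\<close>; the form with a
  sliding window shows that it vanishes off a compact set.\<close>

definition bump_window :: "real \<Rightarrow> real \<Rightarrow> real \<Rightarrow> real \<Rightarrow> real \<Rightarrow> real" where
  "bump_window a c h k x = integral {x - c..x - a} (bump h k)"

lemma bump_window_deriv:
  assumes "a \<le> c"
  shows "(bump_window a c h k has_real_derivative bump h k (x - a) - bump h k (x - c)) (at x)"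
proof -
  have "\<exists>B. \<forall>x. -\<infinity> < ereal x \<longrightarrow> ereal x < \<infinity> \<longrightarrow> (B has_vector_derivative bump h k x) (at x)"
    by (rule einterval_antiderivative) (use bump_continuous[of UNIV h k] in \<open>auto simp: continuous_on_eq_continuous_at\<close>)
  then obtain B where B: "\<And>x. (B has_real_derivative bump h k x) (at x)"
    by (auto simp: has_real_derivative_iff_has_vector_derivative)
  have "bump_window a c h k x = B (x - a) - B (x - c)" for x
    unfolding bump_window_def
    using assms B by (intro integral_unique fundamental_theorem_of_calculus)
      (auto simp: has_real_derivative_iff_has_vector_derivative intro: has_vector_derivative_at_within)
  then have "bump_window a c h k = (\<lambda>x. B (x - a) - B (x - c))"
    by auto
  moreover have "((\<lambda>x. B (x - d)) has_real_derivative bump h k (x - d)) (at x)" for d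
    using B[of "x - d"] DERIV_shift[of B "bump h k (x - d)" x "- d"] by simp
  ultimately show ?thesis
    by (simp add: DERIV_diff)
qed

lemma bump_window_support:
  assumes "k > 0" "x \<notin> {a..c + h}"
  shows "bump_window a c h k x = 0"
  unfolding bump_window_def
proof -
  have "integral {x - c..x - a} (bump h k) = integral {x - c..x - a} (\<lambda>_. 0)"
    using assms by (intro integral_cong bump_eq_0) auto
  then show "integral {x - c..x - a} (bump h k) = 0"
    by simp
qed

lemma bump_window_test_function:
  assumes "a \<le> c" "k > 0"
  shows "test_function (bump_window a c h k)"
  unfolding test_function_def
proof
  have "smooth_upto (Suc n) (bump_window a c h k)" for n
  proof (rule smooth_upto_SucI[OF bump_window_deriv[OF assms(1)]])
    show "smooth_upto n (\<lambda>x. bump h k (x - a) - bump h k (x - c))"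
      using smooth_upto_add[OF smooth_upto_affine[OF bump_smooth, of n h k 1 "- a"]
        smooth_upto_mult[OF smooth_upto_const smooth_upto_affine[OF bump_smooth, of n h k 1 "- c"], of "- 1"]]
      by simp
  qed
  then show "\<forall>n. (deriv ^^ n) (bump_window a c h k) differentiable_on UNIV"
    by (meson order_refl smooth_upto_SucD smooth_upto_iff)
  have "{x. bump_window a c h k x \<noteq> 0} \<subseteq> {a..c + h}"
    using bump_window_support[OF assms(2)] by blast
  then show "compact (closure {x. bump_window a c h k x \<noteq> 0})"
    by (meson bounded_closed_interval bounded_subset compact_closure)
qed

text \<open>The limit of the functions \<open>bump_window a c h k\<close> as \<open>k\<close> tends to infinity: a trapezoid
  of height \<open>h\<close> (if \<open>h \<le> c - a\<close>) that rises on \<open>[a, a + h]\<close> and falls on \<open>[c, c + h]\<close>.\<close>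

definition box_window :: "real \<Rightarrow> real \<Rightarrow> real \<Rightarrow> real \<Rightarrow> real" where
  "box_window a c h x = measure lebesgue ({x - c..x - a} \<inter> {0<..<h})"

lemma bump_window_bounds:
  assumes "a \<le> c"
  shows "\<bar>bump_window a c h k x\<bar> \<le> c - a"
proof -
  have "norm (integral {x - c..x - a} (bump h k)) \<le> integral {x - c..x - a} (\<lambda>_. 1)"
    by (rule Henstock_Kurzweil_Integration.integral_norm_bound_integral) (auto simp: bump_bounds intro!: integrable_continuous_real bump_continuous)
  then show ?thesis
    using assms by (simp add: bump_window_def)
qed

text \<open>Dominated convergence on the sliding window \<open>[x - c, x - a]\<close>.\<close>

lemma bump_window_tendsto:
  "(\<lambda>n. bump_window a c h (real (Suc n)) x) \<longlonglongrightarrow> box_window a c h x"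
proof -
  have "(\<lambda>n. integral {x - c..x - a} (bump h (real (Suc n)))) \<longlonglongrightarrow> integral {x - c..x - a} (indicator {0<..<h})"
  proof (rule dominated_convergence(2)[where h = "\<lambda>_. 1"])
    show "bump h (real (Suc n)) integrable_on {x - c..x - a}" for n
      by (intro integrable_continuous_real bump_continuous)
    show "norm (bump h (real (Suc n)) t) \<le> 1" for n t
      using bump_bounds[of h "real (Suc n)" t] by simp
    show "(\<lambda>n. bump h (real (Suc n)) t) \<longlonglongrightarrow> indicator {0<..<h} t" for t
      by (rule bump_tendsto)
  qed auto
  then show ?thesis
    by (simp add: bump_window_def box_window_def integral_indicator fmeasurable_Int_fmeasurable Int_commute del: of_nat_Suc)
qed

lemma bump_window_continuous: "a \<le> c \<Longrightarrow> continuous_on UNIV (bump_window a c h k)"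
  by (rule DERIV_continuous_on[OF DERIV_subset[OF bump_window_deriv]]) auto

lemma box_window_measurable:
  assumes "a \<le> c"
  shows "box_window a c h \<in> borel_measurable lebesgue"
proof (rule borel_measurable_LIMSEQ_real)
  show "(\<lambda>n. bump_window a c h (real (Suc n)) x) \<longlonglongrightarrow> box_window a c h x" for x
    by (rule bump_window_tendsto)
  show "bump_window a c h (real (Suc n)) \<in> borel_measurable lebesgue" for n
    by (rule borel_measurable_lebesgue_continuous[OF bump_window_continuous[OF assms]])
qed

lemma box_window_bounds: "0 \<le> box_window a c h x" "h > 0 \<Longrightarrow> box_window a c h x \<le> h"
proof -
  have "measure lebesgue ({x - c..x - a} \<inter> {0<..<h}) \<le> measure lebesgue {0<..<h}"
    by (rule measure_mono_fmeasurable) auto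
  then show "h > 0 \<Longrightarrow> box_window a c h x \<le> h"
    by (simp add: box_window_def)
qed (simp add: box_window_def)

lemma box_window_eq_0: "x \<notin> {a<..<c + h} \<Longrightarrow> box_window a c h x = 0"
proof -
  assume "x \<notin> {a<..<c + h}"
  then have e: "{x - c..x - a} \<inter> {0<..<h} = {}"
    by auto
  show ?thesis
    unfolding box_window_def e by simp
qed

lemma box_window_eq: "h > 0 \<Longrightarrow> a + h \<le> x \<Longrightarrow> x \<le> c \<Longrightarrow> box_window a c h x = h"
proof -
  assume *: "h > 0" "a + h \<le> x" "x \<le> c"
  then have e: "{x - c..x - a} \<inter> {0<..<h} = {0<..<h}"
    by auto
  show ?thesis
    unfolding box_window_def e using * by simp
qed

lemma locally_integrable_lint:
  assumes "locally_integrable v" "compact K"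
  shows "integrable lebesgue (\<lambda>x. indicator K x * v x)"
  using assms by (simp add: locally_integrable_def set_integrable_def)

text \<open>The test functions have the derivative \<open>bump (x - a) - bump (x - c)\<close>. As the bumps tend to the
  indicator of \<open>(0, h)\<close>, both sides of the definition of the weak derivative converge by dominated
  convergence.\<close>

lemma weak_deriv_box_window:
  assumes vw: "has_weak_deriv v w" and "a \<le> c" "h > 0"
  shows "integral {a..a + h} v - integral {c..c + h} v = - (LINT x|lebesgue. w x * box_window a c h x)"
proof -
  let ?K = "{a..c + h}"
  have loc: "locally_integrable v" "locally_integrable w"
    using vw by (auto simp: has_weak_deriv_def)
  note v = locally_integrable_lint[OF loc(1), of ?K, simplified]
   and w = locally_integrable_lint[OF loc(2), of ?K, simplified]
  let ?\<phi> = "\<lambda>n. bump_window a c h (real (Suc n))"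
  let ?\<psi> = "\<lambda>n x. bump h (real (Suc n)) (x - a) - bump h (real (Suc n)) (x - c)"
  have \<phi>_meas: "?\<phi> n \<in> borel_measurable lebesgue" for n
    by (rule borel_measurable_lebesgue_continuous[OF bump_window_continuous[OF \<open>a \<le> c\<close>]])
  have \<psi>_meas: "?\<psi> n \<in> borel_measurable lebesgue" for n
  proof -
    have "continuous_on UNIV (\<lambda>x. bump h (real (Suc n)) (x - d))" for d
      by (rule continuous_on_compose2[where t = UNIV, OF bump_continuous]) (auto intro: continuous_on_diff)
    from borel_measurable_lebesgue_continuous[OF continuous_on_diff[OF this this]] show ?thesis .
  qed
  have \<psi>_lim: "(\<lambda>n. ?\<psi> n x) \<longlonglongrightarrow> indicator {0<..<h} (x - a) - indicator {0<..<h} (x - c)" for x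
    by (intro tendsto_intros bump_tendsto)
  have lim_w: "(\<lambda>n. LINT x|lebesgue. (indicator ?K x * w x) * ?\<phi> n x)
      \<longlonglongrightarrow> (LINT x|lebesgue. (indicator ?K x * w x) * box_window a c h x)"
  proof (rule integral_dominated_convergence[where w = "\<lambda>x. \<bar>indicator ?K x * w x\<bar> * (c - a)"])
    show "(\<lambda>x. (indicator ?K x * w x) * box_window a c h x) \<in> borel_measurable lebesgue"
      by (rule borel_measurable_times[OF borel_measurable_integrable[OF w] box_window_measurable[OF \<open>a \<le> c\<close>]])
    show "(\<lambda>x. (indicator ?K x * w x) * ?\<phi> n x) \<in> borel_measurable lebesgue" for n
      by (rule borel_measurable_times[OF borel_measurable_integrable[OF w] \<phi>_meas])
    show "integrable lebesgue (\<lambda>x. \<bar>indicator ?K x * w x\<bar> * (c - a))"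
      using w by (intro integrable_mult_left integrable_abs)
    show "AE x in lebesgue. (\<lambda>n. (indicator ?K x * w x) * ?\<phi> n x) \<longlonglongrightarrow> (indicator ?K x * w x) * box_window a c h x"
      by (intro AE_I2 tendsto_intros bump_window_tendsto)
    show "AE x in lebesgue. norm ((indicator ?K x * w x) * ?\<phi> n x) \<le> \<bar>indicator ?K x * w x\<bar> * (c - a)" for n
      using bump_window_bounds[OF \<open>a \<le> c\<close>] by (intro AE_I2) (simp add: abs_mult mult_left_mono)
  qed
  have e1: "(indicator ?K x * w x) * ?\<phi> n x = w x * ?\<phi> n x" for n x
    using bump_window_support[of "real (Suc n)" x a c h] by (cases "x \<in> ?K") auto
  have e2: "(indicator ?K x * w x) * box_window a c h x = w x * box_window a c h x" for x
    using box_window_eq_0[of x a c h] by (cases "x \<in> ?K") auto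
  note lim_w = lim_w[unfolded e1 e2]
  have \<psi>_bd: "\<bar>?\<psi> n x\<bar> \<le> 1" for n x
    using bump_bounds[of h "real (Suc n)" "x - a"] bump_bounds[of h "real (Suc n)" "x - c"] by linarith
  have lim_v: "(\<lambda>n. LINT x|lebesgue. (indicator ?K x * v x) * ?\<psi> n x)
      \<longlonglongrightarrow> (LINT x|lebesgue. (indicator ?K x * v x) * (indicator {0<..<h} (x - a) - indicator {0<..<h} (x - c)))"
  proof (rule integral_dominated_convergence[where w = "\<lambda>x. \<bar>indicator ?K x * v x\<bar>"])
    show "(\<lambda>x. (indicator ?K x * v x) * (indicator {0<..<h} (x - a) - indicator {0<..<h} (x - c))) \<in> borel_measurable lebesgue"
      by (rule borel_measurable_times[OF borel_measurable_integrable[OF v] borel_measurable_LIMSEQ_real[OF \<psi>_lim \<psi>_meas]])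
    show "(\<lambda>x. (indicator ?K x * v x) * ?\<psi> n x) \<in> borel_measurable lebesgue" for n
      by (rule borel_measurable_times[OF borel_measurable_integrable[OF v] \<psi>_meas])
    show "integrable lebesgue (\<lambda>x. \<bar>indicator ?K x * v x\<bar>)"
      using v by (intro integrable_abs)
    show "AE x in lebesgue. (\<lambda>n. (indicator ?K x * v x) * ?\<psi> n x) \<longlonglongrightarrow>
        (indicator ?K x * v x) * (indicator {0<..<h} (x - a) - indicator {0<..<h} (x - c))"
      by (intro AE_I2 tendsto_mult tendsto_const \<psi>_lim)
    show "AE x in lebesgue. norm ((indicator ?K x * v x) * ?\<psi> n x) \<le> \<bar>indicator ?K x * v x\<bar>" for n
      unfolding real_norm_def abs_mult[of _ "?\<psi> n _"] using \<psi>_bd by (intro AE_I2 mult_left_le) auto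
  qed
  have e3: "(indicator ?K x * v x) * ?\<psi> n x = v x * deriv (?\<phi> n) x" for n x
    using DERIV_imp_deriv[OF bump_window_deriv[OF \<open>a \<le> c\<close>], of h "real (Suc n)" x] bump_eq_0[of "real (Suc n)" _ h] \<open>a \<le> c\<close>
    by (cases "x \<in> ?K") auto
  have e4: "(LINT x|lebesgue. v x * deriv (?\<phi> n) x) = - (LINT x|lebesgue. w x * ?\<phi> n x)" for n
    using vw bump_window_test_function[OF \<open>a \<le> c\<close>, of "real (Suc n)" h]
    unfolding has_weak_deriv_def by (metis of_nat_0_less_iff zero_less_Suc)
  note lim_v = lim_v[unfolded e3 e4]
  have point: "(LINT x|lebesgue. indicator {p<..<p + h} x * v x) = integral {p..p + h} v" for p
  proof -
    have "set_integrable lebesgue {p<..<p + h} v" for p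
      by (rule set_integrable_subset[of lebesgue "{p..p + h}"]) (use loc(1) in \<open>auto simp: locally_integrable_def\<close>)
    from set_lebesgue_integral_eq_integral(2)[OF this]
    show ?thesis
      by (simp add: set_lebesgue_integral_def integral_open_interval_real)
  qed
  from LIMSEQ_unique[OF lim_v tendsto_minus[OF lim_w]]
  have "- (LINT x|lebesgue. w x * box_window a c h x)
    = (LINT x|lebesgue. (indicator ?K x * v x) * (indicator {0<..<h} (x - a) - indicator {0<..<h} (x - c)))"
    by simp
  also have "\<dots> = (LINT x|lebesgue. indicator {a<..<a + h} x * v x - indicator {c<..<c + h} x * v x)"
    using \<open>a \<le> c\<close> by (intro Bochner_Integration.integral_cong) (auto simp: indicator_def)
  also have "\<dots> = (LINT x|lebesgue. indicator {a<..<a + h} x * v x) - (LINT x|lebesgue. indicator {c<..<c + h} x * v x)"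
  proof (rule Bochner_Integration.integral_diff)
    have "set_integrable lebesgue {p<..<p + h} v" for p
      by (rule set_integrable_subset[of lebesgue "{p..p + h}"]) (use loc(1) in \<open>auto simp: locally_integrable_def\<close>)
    then show "integrable lebesgue (\<lambda>x. indicator {a<..<a + h} x * v x)"
      "integrable lebesgue (\<lambda>x. indicator {c<..<c + h} x * v x)"
      by (simp_all add: set_integrable_def)
  qed
  also have "\<dots> = integral {a..a + h} v - integral {c..c + h} v"
    unfolding point ..
  finally show ?thesis
    by simp
qed

lemma locally_integrable_integrable_on: "locally_integrable v \<Longrightarrow> v integrable_on {a..b}"
  by (simp add: locally_integrable_def set_lebesgue_integral_eq_integral(1))

text \<open>Dividing the previous identity by \<open>h\<close> and letting \<open>h\<close> tend to 0, the averages of \<open>v\<close>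
  converge at almost every point by Lebesgue's differentiation theorem, and the normalised window functions
  tend to the indicator of \<open>(a, c]\<close>.\<close>

lemma weak_deriv_difference:
  assumes vw: "has_weak_deriv v w"
  obtains N where "negligible N"
    "\<And>a c. \<lbrakk>a \<notin> N; c \<notin> N; a < c\<rbrakk> \<Longrightarrow> integral {a..c} w = v c - v a"
proof -
  have loc: "locally_integrable v" "locally_integrable w"
    using vw by (auto simp: has_weak_deriv_def)
  obtain N where N: "negligible N"
    and avg: "\<And>x e. \<lbrakk>x \<notin> N; 0 < e\<rbrakk> \<Longrightarrow> \<exists>d>0. \<forall>h. 0 < h \<and> h < d \<longrightarrow>
      norm (integral (cbox x (x + h *\<^sub>R One)) v /\<^sub>R h ^ DIM(real) - v x) < e"
    using integrable_ccontinuous_explicit[of v] locally_integrable_integrable_on[OF loc(1)] by auto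
  let ?h = "\<lambda>n. inverse (real (Suc n))"
  have h: "?h n > 0" "?h n \<le> 1" for n
    by (auto simp: field_simps)
  have lim_avg: "(\<lambda>n. integral {x..x + ?h n} v / ?h n) \<longlonglongrightarrow> v x" if "x \<notin> N" for x
  proof (rule LIMSEQ_I)
    fix e :: real assume "0 < e"
    from avg[OF that this] obtain d where "d > 0"
      and d: "\<And>h. 0 < h \<and> h < d \<Longrightarrow> norm (integral {x..x + h} v /\<^sub>R h - v x) < e"
      by auto
    obtain m where m: "\<And>n. n \<ge> m \<Longrightarrow> ?h n < d"
      using order_tendstoD(2)[OF LIMSEQ_inverse_real_of_nat \<open>d > 0\<close>] by (auto simp: eventually_sequentially)
    show "\<exists>m. \<forall>n\<ge>m. norm (integral {x..x + ?h n} v / ?h n - v x) < e"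
    proof (intro exI allI impI)
      fix n assume "m \<le> n"
      then show "norm (integral {x..x + ?h n} v / ?h n - v x) < e"
        using d[of "?h n"] m[of n] h(1)[of n] by (simp add: divide_inverse mult.commute del: of_nat_Suc)
    qed
  qed
  have "integral {a..c} w = v c - v a" if a: "a \<notin> N" and c: "c \<notin> N" and "a < c" for a c
  proof -
    let ?K = "{a..c + 1}"
    let ?B = "\<lambda>n x. box_window a c (?h n) x / ?h n"
    note w = locally_integrable_lint[OF loc(2), of ?K, simplified]
    have B_meas: "?B n \<in> borel_measurable lebesgue" for n
      using box_window_measurable[of a c] \<open>a < c\<close> by (intro borel_measurable_divide) auto
    have B_lim: "(\<lambda>n. ?B n x) \<longlonglongrightarrow> indicator {a<..c} x" for x
    proof (rule tendsto_eventually)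
      \<comment> \<open>The normalised trapezoid has its limit value at \<open>x\<close> as soon as \<open>h < d\<close>.\<close>
      define d where "d = (if x \<le> a then 1 else if x \<le> c then x - a else x - c)"
      have "d > 0"
        by (auto simp: d_def)
      from order_tendstoD(2)[OF LIMSEQ_inverse_real_of_nat this]
      show "\<forall>\<^sub>F n in sequentially. ?B n x = indicator {a<..c} x"
      proof eventually_elim
        case (elim n)
        show ?case
        proof (cases "x \<in> {a<..c}")
          case True
          then show ?thesis
            using box_window_eq[of "?h n" a x c] h(1)[of n] elim by (simp add: d_def del: of_nat_Suc)
        next
          case False
          then have "x \<notin> {a<..<c + ?h n}"
            using elim by (auto simp: d_def split: if_splits)
          then show ?thesis
            using box_window_eq_0[of x a c "?h n"] False by simp
        qed
      qed
    qed
    have B_bd: "\<bar>?B n x\<bar> \<le> 1" for n x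
      using box_window_bounds(1)[of a c "?h n" x] box_window_bounds(2)[OF h(1)[of n], of a c x] h(1)[of n]
      by (simp add: abs_of_nonneg divide_le_eq del: of_nat_Suc)
    have "(\<lambda>n. LINT x|lebesgue. (indicator ?K x * w x) * ?B n x)
      \<longlonglongrightarrow> (LINT x|lebesgue. (indicator ?K x * w x) * indicator {a<..c} x)"
    proof (rule integral_dominated_convergence[where w = "\<lambda>x. \<bar>indicator ?K x * w x\<bar>"])
      show "(\<lambda>x. (indicator ?K x * w x) * indicator {a<..c} x) \<in> borel_measurable lebesgue"
        by (rule borel_measurable_times[OF borel_measurable_integrable[OF w] borel_measurable_indicator]) simp
      show "(\<lambda>x. (indicator ?K x * w x) * ?B n x) \<in> borel_measurable lebesgue" for n
        by (rule borel_measurable_times[OF borel_measurable_integrable[OF w] B_meas])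
      show "integrable lebesgue (\<lambda>x. \<bar>indicator ?K x * w x\<bar>)"
        using w by (intro integrable_abs)
      show "AE x in lebesgue. (\<lambda>n. (indicator ?K x * w x) * ?B n x) \<longlonglongrightarrow> (indicator ?K x * w x) * indicator {a<..c} x"
        by (intro AE_I2 tendsto_mult tendsto_const B_lim)
      show "AE x in lebesgue. norm ((indicator ?K x * w x) * ?B n x) \<le> \<bar>indicator ?K x * w x\<bar>" for n
        unfolding real_norm_def abs_mult[of _ "?B n _"] using B_bd by (intro AE_I2 mult_left_le) auto
    qed
    moreover have "(LINT x|lebesgue. (indicator ?K x * w x) * ?B n x)
        = integral {c..c + ?h n} v / ?h n - integral {a..a + ?h n} v / ?h n" for n
    proof -
      have e: "(indicator ?K x * w x) * ?B n x = w x * box_window a c (?h n) x / ?h n" for x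
        using box_window_eq_0[of x a c "?h n"] h(2)[of n] by (cases "x \<in> ?K") (auto simp del: of_nat_Suc)
      have "(LINT x|lebesgue. (indicator ?K x * w x) * ?B n x)
          = (LINT x|lebesgue. w x * box_window a c (?h n) x) / ?h n"
        unfolding e by (rule integral_divide_zero)
      also have "(LINT x|lebesgue. w x * box_window a c (?h n) x) = integral {c..c + ?h n} v - integral {a..a + ?h n} v"
        using weak_deriv_box_window[OF vw, of a c "?h n"] \<open>a < c\<close> h(1)[of n] by linarith
      finally show ?thesis
        by (simp add: diff_divide_distrib)
    qed
    ultimately have "(\<lambda>n. integral {c..c + ?h n} v / ?h n - integral {a..a + ?h n} v / ?h n)
        \<longlonglongrightarrow> (LINT x|lebesgue. (indicator ?K x * w x) * indicator {a<..c} x)"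
      by (simp only:)
    from LIMSEQ_unique[OF this tendsto_diff[OF lim_avg[OF c] lim_avg[OF a]]]
    have "v c - v a = (LINT x|lebesgue. (indicator ?K x * w x) * indicator {a<..c} x)"
      by simp
    also have "\<dots> = (LINT x:{a<..c}|lebesgue. w x)"
      unfolding set_lebesgue_integral_def
      by (intro Bochner_Integration.integral_cong) (auto simp: indicator_def)
    also have "\<dots> = integral {a<..c} w"
    proof (rule set_lebesgue_integral_eq_integral(2))
      show "set_integrable lebesgue {a<..c} w"
        by (rule set_integrable_subset[of lebesgue "{a..c}"]) (use loc(2) in \<open>auto simp: locally_integrable_def\<close>)
    qed
    also have "\<dots> = integral {a..c} w"
      by (rule integral_subset_negligible) (auto intro: negligible_subset[of "{a}"])
    finally show ?thesis
      by simp
  qed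
  with N show thesis
    by (rule that)
qed

lemma locally_integrable_primitive:
  assumes "locally_integrable w"
  obtains W where "continuous_on UNIV W" "\<And>a c. a \<le> c \<Longrightarrow> integral {a..c} w = W c - W a"
proof -
  have int: "w integrable_on {a..b}" for a b
    by (rule locally_integrable_integrable_on[OF assms])
  define W where "W x = (if 0 \<le> x then integral {0..x} w else - integral {x..0} w)" for x
  have W: "integral {a..c} w = W c - W a" if "a \<le> c" for a c
    using that Henstock_Kurzweil_Integration.integral_combine[of a 0 c w] Henstock_Kurzweil_Integration.integral_combine[of 0 a c w]
      Henstock_Kurzweil_Integration.integral_combine[of a c 0 w] int
    by (auto simp: W_def not_le algebra_simps)
  have "isCont W x" for x
  proof -
    have "continuous_on {x - 1..x + 1} (\<lambda>y. W (x - 1) + integral {x - 1..y} w)"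
      by (intro continuous_intros indefinite_integral_continuous_1 int)
    then have "continuous_on {x - 1..x + 1} W"
      by (rule continuous_on_eq) (simp add: W)
    then show ?thesis
      by (rule continuous_on_interior) simp
  qed
  then show thesis
    using that[of W] W by (auto simp: continuous_on_eq_continuous_at)
qed

lemma weak_deriv_primitive:
  assumes "has_weak_deriv v w"
  obtains V where "continuous_on UNIV V" "AE x in lebesgue. v x = V x"
    "\<And>a c. a \<le> c \<Longrightarrow> integral {a..c} w = V c - V a"
proof -
  obtain N where N: "negligible N"
    and diff: "\<And>a c. \<lbrakk>a \<notin> N; c \<notin> N; a < c\<rbrakk> \<Longrightarrow> integral {a..c} w = v c - v a"
    using weak_deriv_difference[OF assms] by metis
  obtain W where W: "continuous_on UNIV W" "\<And>a c. a \<le> c \<Longrightarrow> integral {a..c} w = W c - W a"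
    using locally_integrable_primitive assms unfolding has_weak_deriv_def by metis
  obtain p where p: "p \<notin> N"
    using N non_negligible_UNIV by (metis UNIV_eq_I)
  define V where "V x = v p - W p + W x" for x
  have "v x = V x" if "x \<notin> N" for x
    using diff[OF p that] diff[OF that p] W(2)[of p x] W(2)[of x p]
    by (cases x p rule: linorder_cases) (auto simp: V_def)
  then have "AE x in lebesgue. v x = V x"
    using N by (intro AE_I'[of N]) (auto simp: negligible_iff_null_sets)
  moreover have "continuous_on UNIV V"
    unfolding V_def[abs_def] by (intro continuous_intros W)
  ultimately show thesis
    using that[of V] W(2) by (simp add: V_def)
qed

lemma AE_lebesgue_eq_continuous:
  fixes f g :: "real \<Rightarrow> real"
  assumes ae: "AE x in lebesgue. f x = g x" and f: "continuous_on UNIV f" and g: "continuous_on UNIV g"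
  shows "f x = g x"
proof (rule ccontr)
  assume "f x \<noteq> g x"
  have "open {x. f x \<noteq> g x}"
    using open_Collect_neq[OF f g] .
  moreover have "negligible {x. f x \<noteq> g x}"
    using ae by (simp add: negligible_iff_null_sets AE_iff_null_sets[symmetric] completion.AE_iff_null_sets)
  ultimately show False
    using open_not_negligible \<open>f x \<noteq> g x\<close> by blast
qed

text \<open>A weak derivative with a continuous representative is a classical derivative, because its
  primitive is continuously differentiable.\<close>

lemma weak_deriv_classical:
  assumes "has_weak_deriv v w" and ae: "AE x in lebesgue. w x = g x" and g: "continuous_on UNIV g"
  obtains V where "AE x in lebesgue. v x = V x" "\<And>x. (V has_real_derivative g x) (at x)"
proof -
  obtain V where V: "AE x in lebesgue. v x = V x" "\<And>a c. a \<le> c \<Longrightarrow> integral {a..c} w = V c - V a"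
    using weak_deriv_primitive[OF assms(1)] by metis
  obtain N where N: "negligible N" "{x. w x \<noteq> g x} \<subseteq> N"
    using ae by (auto simp: eventually_ae_filter negligible_iff_null_sets)
  have "g x = w x" if "x \<notin> N" for x
  proof (rule ccontr)
    assume "g x \<noteq> w x"
    then have "x \<in> {x. w x \<noteq> g x}"
      by simp
    with subsetD[OF N(2)] that show False
      by blast
  qed
  then have w_g: "integral {a..c} w = integral {a..c} g" for a c
    by (intro integral_spike[OF N(1)]) auto
  have "(V has_real_derivative g x) (at x)" for x
  proof -
    have "((\<lambda>y. integral {x - 1..y} g) has_real_derivative g x) (at x within {x - 1..x + 1})"
      by (rule integral_has_real_derivative) (auto intro: continuous_on_subset[OF g])
    then have "((\<lambda>y. integral {x - 1..y} g) has_real_derivative g x) (at x)"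
      by (simp add: at_within_Icc_at)
    from DERIV_add[OF DERIV_const this]
    have "((\<lambda>y. V (x - 1) + integral {x - 1..y} g) has_real_derivative g x) (at x)"
      by simp
    then show ?thesis
      by (rule has_field_derivative_transform_within_open[of _ _ _ "{x - 1<..<x + 1}"])
         (use V(2)[of "x - 1"] in \<open>auto simp: w_g\<close>)
  qed
  with V(1) show thesis
    by (rule that)
qed

section \<open>Decay at minus infinity\<close>

text \<open>This is the Cauchy-Schwarz inequality on an interval of length at most 1, obtained by
  integrating \<open>(h - m)\<^sup>2 \<ge> 0\<close> for \<open>m = \<integral> h\<close>.\<close>

lemma square_integral_bound:
  fixes h :: "real \<Rightarrow> real"
  assumes "x \<le> y" "y \<le> x + 1"
    and h: "h integrable_on {x..y}" and h2: "(\<lambda>t. (h t)\<^sup>2) integrable_on {x..y}"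
  shows "(integral {x..y} h)\<^sup>2 \<le> integral {x..y} (\<lambda>t. (h t)\<^sup>2)"
proof -
  define m where "m = integral {x..y} h"
  have "((\<lambda>t. (h t)\<^sup>2 - 2 * m * h t + m\<^sup>2) has_integral
      integral {x..y} (\<lambda>t. (h t)\<^sup>2) - 2 * m * m + m\<^sup>2 * (y - x)) {x..y}"
    using has_integral_const_real[of "m\<^sup>2" x y] \<open>x \<le> y\<close> unfolding m_def
    by (intro has_integral_add has_integral_diff has_integral_mult_right integrable_integral h h2)
       (simp_all add: mult.commute)
  then have "0 \<le> integral {x..y} (\<lambda>t. (h t)\<^sup>2) - 2 * m * m + m\<^sup>2 * (y - x)"
  proof (rule has_integral_nonneg)
    show "0 \<le> (h t)\<^sup>2 - 2 * m * h t + m\<^sup>2" for t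
      using zero_le_power2[of "h t - m"] by (simp add: power2_diff algebra_simps)
  qed
  moreover have "m\<^sup>2 * (y - x) \<le> m\<^sup>2 * 1"
    using assms by (intro mult_left_mono) auto
  ultimately show ?thesis
    by (simp add: m_def power2_eq_square)
qed

text \<open>The integral over \<open>[x, x + 1]\<close> is a difference of two integrals over \<open>[x, 0]\<close> and \<open>[x + 1, 0]\<close>
  that have the same limit.\<close>

lemma integrable_unit_window_tendsto_0:
  fixes f :: "real \<Rightarrow> real"
  assumes f: "integrable lebesgue f"
  shows "((\<lambda>x. integral {x..x + 1} f) \<longlongrightarrow> 0) at_bot"
proof -
  have int: "set_integrable lebesgue S f" if "S \<in> sets lebesgue" for S
    using set_integrable_subset[of lebesgue UNIV f S] f that by (simp add: set_integrable_def)
  let ?A = "\<lambda>a. integral {a..0} f"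
  have A: "(LINT x:{a..0}|lebesgue. f x) = ?A a" for a
    by (rule set_lebesgue_integral_eq_integral(2)) (simp add: int)
  have lim: "(?A \<longlongrightarrow> (LINT x:{..0}|lebesgue. f x)) at_bot"
    using tendsto_set_lebesgue_integral_at_bot[of "0::real" lebesgue f] int by (simp add: A)
  have "filterlim (\<lambda>x::real. x + 1) at_bot at_bot"
    unfolding filterlim_at_bot eventually_at_bot_linorder by (metis le_diff_eq)
  from tendsto_diff[OF lim filterlim_compose[OF lim this]]
  have "((\<lambda>x. ?A x - ?A (x + 1)) \<longlongrightarrow> 0) at_bot"
    by simp
  moreover have "\<forall>\<^sub>F x in at_bot. ?A x - ?A (x + 1) = integral {x..x + 1} f"
    using eventually_le_at_bot[of "- 1"]
  proof eventually_elim
    case (elim x)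
    have "integral {x..x + 1} f + integral {x + 1..0} f = integral {x..0} f"
      using elim by (intro Henstock_Kurzweil_Integration.integral_combine set_lebesgue_integral_eq_integral(1) int) auto
    then show ?case
      by simp
  qed
  ultimately show ?thesis
    by (rule Lim_transform_eventually)
qed

text \<open>Comparing \<open>U x\<close> with \<open>U y\<close> for \<open>y\<close> in \<open>[x, x + 1]\<close> by means of the weak derivative \<open>h\<close>, and
  averaging over \<open>y\<close>, gives \<open>(U x)\<^sup>2 \<le> 2 \<integral> (U\<^sup>2 + h\<^sup>2)\<close> over \<open>[x, x + 1]\<close>.\<close>

lemma H1_real_tendsto_0_at_bot:
  assumes u: "u \<in> H1_real" and U: "continuous_on UNIV U" and ae: "AE x in lebesgue. u x = U x"
  shows "(U \<longlongrightarrow> 0) at_bot" and "integrable lebesgue (\<lambda>x. (U x)\<^sup>2)"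
proof -
  obtain h where h: "h \<in> L2_real" "has_weak_deriv u h"
    using u by (auto simp: H1_real_def)
  obtain V where V: "continuous_on UNIV V" "AE x in lebesgue. u x = V x"
    and V_int: "\<And>a c. a \<le> c \<Longrightarrow> integral {a..c} h = V c - V a"
    using weak_deriv_primitive[OF h(2)] by metis
  have "AE x in lebesgue. U x = V x"
    using ae V(2) by eventually_elim simp
  from AE_lebesgue_eq_continuous[OF this U V(1)] have "U x = V x" for x .
  then have U_int: "integral {a..c} h = U c - U a" if "a \<le> c" for a c
    using V_int[OF that] by simp
  have h2: "integrable lebesgue (\<lambda>x. (h x)\<^sup>2)"
    using h by (simp add: L2_real_def)
  have "integrable lebesgue (\<lambda>x. (u x)\<^sup>2)"
    using u by (simp add: H1_real_def L2_real_def)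
  then show U2: "integrable lebesgue (\<lambda>x. (U x)\<^sup>2)"
  proof (rule integrable_cong_AE_imp)
    show "(\<lambda>x. (U x)\<^sup>2) \<in> borel_measurable lebesgue"
      by (intro borel_measurable_lebesgue_continuous continuous_intros U)
    show "AE x in lebesgue. (u x)\<^sup>2 = (U x)\<^sup>2"
      using ae by eventually_elim simp
  qed
  have int_on: "f integrable_on {a..b}" if "integrable lebesgue f" for f :: "real \<Rightarrow> real" and a b
    by (rule integrable_on_subinterval[OF integrable_on_lebesgue[OF that]]) simp
  let ?G = "\<lambda>x. (U x)\<^sup>2 + (h x)\<^sup>2"
  have "integrable lebesgue ?G"
    using U2 h2 by simp
  note lim = tendsto_mult_right_zero[OF integrable_unit_window_tendsto_0[OF this], of 2]
  have bound: "(U x)\<^sup>2 \<le> 2 * integral {x..x + 1} ?G" for x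
  proof -
    let ?H = "integral {x..x + 1} (\<lambda>t. (h t)\<^sup>2)"
    have pt: "(U x)\<^sup>2 \<le> 2 * (U y)\<^sup>2 + 2 * ?H" if y: "y \<in> {x..x + 1}" for y
    proof -
      have "(U y - U x)\<^sup>2 = (integral {x..y} h)\<^sup>2"
        using U_int[of x y] y by simp
      also have "\<dots> \<le> integral {x..y} (\<lambda>t. (h t)\<^sup>2)"
        using y h(2) by (intro square_integral_bound int_on h2 locally_integrable_integrable_on)
          (auto simp: has_weak_deriv_def)
      also have "\<dots> \<le> ?H"
        using y by (intro integral_subset_le int_on h2) auto
      finally have "(U y - U x)\<^sup>2 \<le> ?H" .
      moreover have "(U x)\<^sup>2 \<le> 2 * (U y)\<^sup>2 + 2 * (U y - U x)\<^sup>2"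
        using zero_le_power2[of "2 * U y - U x"] by (simp add: power2_eq_square algebra_simps)
      ultimately show ?thesis
        by linarith
    qed
    have "((\<lambda>y. 2 * (U y)\<^sup>2 + 2 * ?H) has_integral
        2 * integral {x..x + 1} (\<lambda>y. (U y)\<^sup>2) + 2 * ?H) {x..x + 1}"
      using has_integral_const_real[of ?H x "x + 1"]
      by (intro has_integral_add has_integral_mult_right integrable_integral int_on U2) simp
    note upper = this
    have "((\<lambda>y. (U x)\<^sup>2) has_integral (U x)\<^sup>2) {x..x + 1}"
      using has_integral_const_real[of "(U x)\<^sup>2" x "x + 1"] by simp
    from has_integral_le[OF this upper pt]
    have "(U x)\<^sup>2 \<le> 2 * integral {x..x + 1} (\<lambda>y. (U y)\<^sup>2) + 2 * ?H" .
    also have "\<dots> = 2 * integral {x..x + 1} ?G"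
      by (simp add: Henstock_Kurzweil_Integration.integral_add int_on U2 h2)
    finally show ?thesis .
  qed
  have "((\<lambda>x. (U x)\<^sup>2) \<longlongrightarrow> 0) at_bot"
    by (rule tendsto_sandwich[OF _ _ tendsto_const lim]) (auto simp: bound)
  from tendsto_real_sqrt[OF this] show "(U \<longlongrightarrow> 0) at_bot"
    by (simp add: tendsto_rabs_zero_iff)
qed

text \<open>On \<open>[x, x + 1]\<close> the derivative \<open>V\<close> takes the value \<open>U (x + 1) - U x\<close>, which is small, and it
  varies by at most the supremum of its own derivative \<open>g\<close>.\<close>

lemma deriv_tendsto_0_at_bot:
  fixes U V g :: "real \<Rightarrow> real"
  assumes dU: "\<And>x. (U has_real_derivative V x) (at x)" and dV: "\<And>x. (V has_real_derivative g x) (at x)"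
    and U: "(U \<longlongrightarrow> 0) at_bot" and g: "(g \<longlongrightarrow> 0) at_bot"
  shows "(V \<longlongrightarrow> 0) at_bot"
proof (rule tendstoI)
  fix e :: real assume "e > 0"
  then have "\<forall>\<^sub>F x in at_bot. dist (U x) 0 < e / 3 \<and> dist (g x) 0 < e / 3"
    using tendstoD[OF U, of "e / 3"] tendstoD[OF g, of "e / 3"] by (auto elim: eventually_elim2)
  then obtain M where M: "\<And>x. x \<le> M \<Longrightarrow> \<bar>U x\<bar> < e / 3 \<and> \<bar>g x\<bar> < e / 3"
    by (auto simp: eventually_at_bot_linorder)
  show "\<forall>\<^sub>F x in at_bot. dist (V x) 0 < e"
    using eventually_le_at_bot[of "M - 1"]
  proof eventually_elim
    case (elim x)
    obtain p where p: "x < p" "p < x + 1" "U (x + 1) - U x = (x + 1 - x) * V p"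
      using MVT2[of x "x + 1" U V] dU by auto
    obtain q where q: "x < q" "q < p" "V p - V x = (p - x) * g q"
      using MVT2[of x p V g] dV p(1) by auto
    have "\<bar>V p - V x\<bar> \<le> 1 * \<bar>g q\<bar>"
      unfolding q(3) abs_mult using p by (intro mult_right_mono) auto
    moreover have "\<bar>V p\<bar> < e / 3 + e / 3"
      using p(3) M[of x] M[of "x + 1"] elim by auto
    moreover have "\<bar>g q\<bar> < e / 3"
      using M[of q] q p elim by auto
    ultimately show ?case
      by simp
  qed
qed

lemma integrable_primitive_at_bot:
  fixes f :: "real \<Rightarrow> real"
  assumes f: "integrable lebesgue f" and cont: "continuous_on UNIV f"
  defines "F \<equiv> \<lambda>x. LINT t:{..x}|lebesgue. f t"
  shows "(F has_real_derivative f x) (at x)" and "(F \<longlongrightarrow> 0) at_bot"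
proof -
  have int: "set_integrable lebesgue S f" if "S \<in> sets lebesgue" for S
    using set_integrable_subset[of lebesgue UNIV f S] f that by (simp add: set_integrable_def)
  have "\<exists>P. \<forall>x. -\<infinity> < ereal x \<longrightarrow> ereal x < \<infinity> \<longrightarrow> (P has_vector_derivative f x) (at x)"
    by (rule einterval_antiderivative) (use cont in \<open>auto simp: continuous_on_eq_continuous_at\<close>)
  then obtain P where P: "\<And>x. (P has_real_derivative f x) (at x)"
    by (auto simp: has_real_derivative_iff_has_vector_derivative)
  have P_int: "(LINT t:{a..b}|lebesgue. f t) = P b - P a" if "a \<le> b" for a b
  proof -
    have "integral {a..b} f = P b - P a"
      using that P by (intro integral_unique fundamental_theorem_of_calculus)
        (auto simp: has_real_derivative_iff_has_vector_derivative intro: has_vector_derivative_at_within)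
    then show ?thesis
      using set_lebesgue_integral_eq_integral(2)[of "{a..b}" f] int by simp
  qed
  have lim: "((\<lambda>a. P x - P a) \<longlongrightarrow> F x) at_bot" for x
  proof (rule Lim_transform_eventually)
    show "((\<lambda>a. LINT t:{a..x}|lebesgue. f t) \<longlongrightarrow> F x) at_bot"
      unfolding F_def by (rule tendsto_set_lebesgue_integral_at_bot) (simp_all add: int)
    show "\<forall>\<^sub>F a in at_bot. (LINT t:{a..x}|lebesgue. f t) = P x - P a"
      using eventually_le_at_bot[of x] by eventually_elim (rule P_int)
  qed
  have F_eq: "F x = P x - (P 0 - F 0)" for x
  proof -
    have "((\<lambda>a. (P x - P 0) + (P 0 - P a)) \<longlongrightarrow> (P x - P 0) + F 0) at_bot"
      by (intro tendsto_intros lim)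
    then have "((\<lambda>a. P x - P a) \<longlongrightarrow> (P x - P 0) + F 0) at_bot"
      by simp
    then have "F x = (P x - P 0) + F 0"
      using lim[of x] by (metis tendsto_unique trivial_limit_at_bot_linorder)
    then show ?thesis
      by simp
  qed
  then have F_fun: "F = (\<lambda>x. P x - (P 0 - F 0))"
    by (rule ext)
  show "(F has_real_derivative f x) (at x)"
    by (subst F_fun) (rule DERIV_cong[OF DERIV_diff[OF P DERIV_const]], simp)
  have "((\<lambda>a. F 0 - (P 0 - P a)) \<longlongrightarrow> F 0 - F 0) at_bot"
    by (intro tendsto_intros lim)
  then show "(F \<longlongrightarrow> 0) at_bot"
    by (subst F_fun) (simp add: algebra_simps)
qed

section \<open>Weak solutions on the line\<close>

text \<open>From \<open>u = T y\<close>, \<open>T W = 1\<close> and \<open>W g = f y\<close> one gets \<open>f u = T (f y) = T W g = g\<close>.\<close>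

lemma classical_soliton_formula:
  fixes \<eta> :: "real^3" and u u' :: "3 \<Rightarrow> real \<Rightarrow> real"
  assumes \<eta>: "\<And>i. \<eta>$i > 0"
    and du: "\<And>i x. (u i has_real_derivative u' i x) (at x)"
    and du': "\<And>i x. (u' i has_real_derivative
                 (\<eta>$i)\<^sup>2 * u i x - 2 * (\<Sum>k\<in>UNIV. (u k x)\<^sup>2) * u i x) (at x)"
    and lim_u: "\<And>i. (u i \<longlongrightarrow> 0) at_bot"
    and L2: "\<And>i. integrable lebesgue (\<lambda>x. (u i x)\<^sup>2)"
  obtains a :: "real^3" where "\<And>i x. u i x = soliton_num \<eta> a i x / soliton_den \<eta> a x"
proof -
  have cont: "continuous_on UNIV (u i)" for i
    by (rule DERIV_continuous_on[OF DERIV_subset[OF du]]) simp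
  have lim_u': "(u' i \<longlongrightarrow> 0) at_bot" for i
  proof (rule deriv_tendsto_0_at_bot[OF du du' lim_u])
    show "((\<lambda>x. (\<eta>$i)\<^sup>2 * u i x - 2 * (\<Sum>k\<in>UNIV. (u k x)\<^sup>2) * u i x) \<longlongrightarrow> 0) at_bot"
      by (rule tendsto_eq_intros lim_u refl | simp)+
  qed
  have int: "integrable lebesgue (\<lambda>x. u i x * u j x)" for i j
  proof (rule Bochner_Integration.integrable_bound)
    show "integrable lebesgue (\<lambda>x. (u i x)\<^sup>2 + (u j x)\<^sup>2)"
      by (intro Bochner_Integration.integrable_add L2)
    show "(\<lambda>x. u i x * u j x) \<in> borel_measurable lebesgue"
      by (intro borel_measurable_lebesgue_continuous continuous_on_mult cont)
    have "norm (u i x * u j x) \<le> norm ((u i x)\<^sup>2 + (u j x)\<^sup>2)" for x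
    proof -
      have "\<bar>u i x * u j x\<bar> \<le> (u i x)\<^sup>2 + (u j x)\<^sup>2"
        using zero_le_power2[of "u i x - u j x"] zero_le_power2[of "u i x + u j x"]
          zero_le_power2[of "u i x"] zero_le_power2[of "u j x"]
        unfolding power2_diff power2_sum by linarith
      then show ?thesis
        by simp
    qed
    then show "AE x in lebesgue. norm (u i x * u j x) \<le> norm ((u i x)\<^sup>2 + (u j x)\<^sup>2)"
      by simp
  qed
  define Q where "Q = (\<lambda>i j x. LINT t:{..x}|lebesgue. u i t * u j t)"
  have dQ: "(Q i j has_real_derivative u i x * u j x) (at x)" for i j x
    unfolding Q_def by (rule integrable_primitive_at_bot(1)[OF int continuous_on_mult[OF cont cont]])
  have lim_Q: "(Q i j \<longlongrightarrow> 0) at_bot" for i j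
    unfolding Q_def by (rule integrable_primitive_at_bot(2)[OF int continuous_on_mult[OF cont cont]])
  have Q_sym: "Q i j x = Q j i x" for i j x
    by (simp add: Q_def mult.commute)
  note first = first_order_system[of "\<lambda>i. \<eta>$i" u u' Q, OF \<eta> du du' dQ Q_sym lim_u lim_u' lim_Q]
  have du1: "(u i has_real_derivative \<eta>$i * u i x - (\<Sum>j\<in>UNIV. Q i j x * u j x)) (at x)" for i x
    using du[of i x] unfolding first(1) .
  obtain b T where
    uT: "\<And>i x. u i x = (\<Sum>j\<in>UNIV. T i j x * (b j * exp (\<eta>$j * x)))" and
    TW: "\<And>i j x. (\<Sum>k\<in>UNIV. T i k x * ((if k = j then 1 else 0)
        + b k * exp (\<eta>$k * x) * (b j * exp (\<eta>$j * x))) / (\<eta>$k + \<eta>$j)) = (if i = j then 1 else 0)"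
    by (rule linear_soliton_system[of "\<lambda>i. \<eta>$i" u Q, OF \<eta> du1 dQ Q_sym first(2) lim_Q]) blast
  define a :: "real^3" where "a = (\<chi> i. 2 * \<eta>$i * b i)"
  have "u i x = soliton_num \<eta> a i x / soliton_den \<eta> a x" for i x
  proof -
    define y where "y j = b j * exp (\<eta>$j * x)" for j
    define W where "W j k = ((if j = k then 1 else 0) + y j * y k) / (\<eta>$j + \<eta>$k)" for j k
    have gram: "(\<Sum>k\<in>UNIV. W j k * soliton_num \<eta> a k x) = y j * soliton_den \<eta> a x" for j
      using soliton_gram_system[OF \<eta>, of a "\<chi> i. b i" j x] by (simp add: a_def W_def y_def)
    have TW': "(\<Sum>j\<in>UNIV. T i j x * W j k) = (if i = k then 1 else 0)" for k
      using TW[of i x k] by (simp add: W_def y_def)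
    have "u i x * soliton_den \<eta> a x = (\<Sum>j\<in>UNIV. T i j x * (y j * soliton_den \<eta> a x))"
      by (simp add: uT y_def sum_distrib_right mult.assoc)
    also have "\<dots> = (\<Sum>j\<in>UNIV. \<Sum>k\<in>UNIV. T i j x * W j k * soliton_num \<eta> a k x)"
      by (simp add: gram[symmetric] sum_distrib_left mult.assoc)
    also have "\<dots> = (\<Sum>k\<in>UNIV. (\<Sum>j\<in>UNIV. T i j x * W j k) * soliton_num \<eta> a k x)"
      unfolding sum_distrib_right by (rule sum.swap)
    also have "\<dots> = soliton_num \<eta> a i x"
      using sum_kronecker(1)[of i "\<lambda>_. 1"] by (simp add: TW')
    finally show ?thesis
      using soliton_den_pos[OF \<eta>, of a x] by (simp add: field_simps)
  qed
  then show thesis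
    by (rule that)
qed

text \<open>The continuous representatives \<open>U\<^sub>i\<close> make the right-hand sides of the equations continuous, and
  the classical derivatives are then recovered one order at a time, beginning with the second.\<close>

lemma weak_solution_classical:
  fixes \<mu> :: "real^'n::finite" and u :: "real \<Rightarrow> real^'n"
  assumes "\<And>i. \<exists>w. has_weak_second_deriv (\<lambda>x. u x $ i) w \<and>
           (AE x in lebesgue. w x + 2 * (\<Sum>k\<in>UNIV. (u x $ k)\<^sup>2) * u x $ i = - \<mu>$i * u x $ i)"
  obtains U U' where "\<And>i. AE x in lebesgue. u x $ i = U i x"
    "\<And>i x. (U i has_real_derivative U' i x) (at x)"
    "\<And>i x. (U' i has_real_derivative - \<mu>$i * U i x - 2 * (\<Sum>k\<in>UNIV. (U k x)\<^sup>2) * U i x) (at x)"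
proof -
  let ?eq = "\<lambda>i w. AE x in lebesgue. w x + 2 * (\<Sum>k\<in>UNIV. (u x $ k)\<^sup>2) * u x $ i = - \<mu>$i * u x $ i"
  have "\<forall>i. \<exists>v. \<exists>w. has_weak_deriv (\<lambda>x. u x $ i) v \<and> has_weak_deriv v w \<and> ?eq i w"
    using assms unfolding has_weak_second_deriv_def by blast
  from choice[OF this] obtain v
    where "\<forall>i. \<exists>w. has_weak_deriv (\<lambda>x. u x $ i) (v i) \<and> has_weak_deriv (v i) w \<and> ?eq i w" ..
  from choice[OF this] obtain w
    where "\<forall>i. has_weak_deriv (\<lambda>x. u x $ i) (v i) \<and> has_weak_deriv (v i) (w i) \<and> ?eq i (w i)" ..
  then have uv: "\<And>i. has_weak_deriv (\<lambda>x. u x $ i) (v i)" and vw: "\<And>i. has_weak_deriv (v i) (w i)"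
    and eq: "\<And>i. ?eq i (w i)"
    by blast+
  have "\<forall>i. \<exists>U. continuous_on UNIV U \<and> (AE x in lebesgue. u x $ i = U x)"
    using weak_deriv_primitive[OF uv] by blast
  from choice[OF this] obtain U where U: "\<And>i. continuous_on UNIV (U i)" and uU: "\<And>i. AE x in lebesgue. u x $ i = U i x"
    by blast
  define g where "g = (\<lambda>i x. - \<mu>$i * U i x - 2 * (\<Sum>k\<in>UNIV. (U k x)\<^sup>2) * U i x)"
  have g: "continuous_on UNIV (g i)" for i
    unfolding g_def by (intro continuous_intros U)
  have wg: "AE x in lebesgue. w i x = g i x" for i
  proof -
    have "AE x in lebesgue. \<forall>k. u x $ k = U k x"
      using uU by (simp add: AE_all_countable)
    with eq[of i] show ?thesis
      by eventually_elim (simp add: g_def)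
  qed
  have "\<forall>i. \<exists>V. (AE x in lebesgue. v i x = V x) \<and> (\<forall>x. (V has_real_derivative g i x) (at x))"
    using weak_deriv_classical[OF vw wg g] by blast
  from choice[OF this] obtain V where vV: "\<And>i. AE x in lebesgue. v i x = V i x" and
    dV: "\<And>i x. (V i has_real_derivative g i x) (at x)"
    by blast
  have "(U i has_real_derivative V i x) (at x)" for i x
  proof -
    have V: "continuous_on UNIV (V i)"
      by (rule DERIV_continuous_on[OF DERIV_subset[OF dV]]) simp
    obtain P where P: "AE x in lebesgue. u x $ i = P x" "\<And>x. (P has_real_derivative V i x) (at x)"
      by (rule weak_deriv_classical[OF uv[of i] vV[of i] V]) blast
    have "AE x in lebesgue. U i x = P x"
      using uU[of i] P(1) by eventually_elim simp
    moreover have "continuous_on UNIV P"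
      by (rule DERIV_continuous_on[OF DERIV_subset[OF P(2)]]) simp
    ultimately have "U i = P"
      using AE_lebesgue_eq_continuous[OF _ U] by blast
    with P(2) show ?thesis
      by simp
  qed
  from that[OF uU this dV[unfolded g_def]] show thesis .
qed

lemma soliton_continuous:
  assumes "\<And>i. \<eta>$i > 0"
  shows "continuous_on UNIV (\<lambda>x. soliton_num \<eta> a i x / soliton_den \<eta> a x)"
proof -
  have "continuous_on UNIV (\<lambda>x. c * exp (d * x))" for c d :: real
    by (intro continuous_intros)
  then have "continuous_on UNIV (\<lambda>x. soliton_num \<eta> a i x)" "continuous_on UNIV (\<lambda>x. soliton_den \<eta> a x)"
    unfolding soliton_num_def soliton_den_def case_prod_beta
    by (intro continuous_on_add continuous_on_sum continuous_on_const; assumption)+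
  then show ?thesis
    using soliton_den_pos[OF assms, of a] by (intro continuous_on_divide) (auto simp: less_imp_neq[THEN not_sym])
qed

theorem theorem1p1:
  fixes \<mu> \<eta> :: "real^3" and u :: "real \<Rightarrow> real^3"
  assumes "\<mu>$1 \<le> \<mu>$2" and "\<mu>$2 \<le> \<mu>$3" and "\<mu>$3 < 0"
    and "\<forall>i. \<eta>$i = sqrt \<bar>\<mu>$i\<bar>"
    and "\<forall>i. (\<lambda>x. u x $ i) \<in> H1_real"
    and "\<forall>i. \<exists>w. has_weak_second_deriv (\<lambda>x. u x $ i) w \<and>
           (AE x in lebesgue.
              w x + 2 * ((u x $ 1)\<^sup>2 + (u x $ 2)\<^sup>2 + (u x $ 3)\<^sup>2) * u x $ i = - \<mu>$i * u x $ i)"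
  shows "\<exists>a :: real^3. \<forall>i.
           (AE x in lebesgue. u x $ i = soliton_num \<eta> a i x / soliton_den \<eta> a x) \<and>
           (continuous_on UNIV (\<lambda>x. u x $ i) \<longrightarrow>
              (\<forall>x. u x $ i = soliton_num \<eta> a i x / soliton_den \<eta> a x))"
proof -
  have "\<mu>$i < 0" for i
    using exhaust_3[of i] assms(1-3) by auto
  then have \<eta>: "\<eta>$i > 0" and \<eta>_sq: "(\<eta>$i)\<^sup>2 = - \<mu>$i" for i
    using assms(4) by (auto simp: less_imp_le abs_of_neg)
  have "\<exists>w. has_weak_second_deriv (\<lambda>x. u x $ i) w \<and>
     (AE x in lebesgue. w x + 2 * (\<Sum>k\<in>UNIV. (u x $ k)\<^sup>2) * u x $ i = - \<mu>$i * u x $ i)" for i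
    using assms(6) by (simp add: sum_3)
  from weak_solution_classical[OF this] obtain U U' where
    uU: "\<And>i. AE x in lebesgue. u x $ i = U i x" and
    dU: "\<And>i x. (U i has_real_derivative U' i x) (at x)" and
    dU': "\<And>i x. (U' i has_real_derivative - \<mu>$i * U i x - 2 * (\<Sum>k\<in>UNIV. (U k x)\<^sup>2) * U i x) (at x)"
    by blast
  have U: "continuous_on UNIV (U i)" for i
    by (rule DERIV_continuous_on[OF DERIV_subset[OF dU]]) simp
  note decay = H1_real_tendsto_0_at_bot[OF assms(5)[rule_format] U uU]
  obtain a :: "real^3" where a: "\<And>i x. U i x = soliton_num \<eta> a i x / soliton_den \<eta> a x"
    by (rule classical_soliton_formula[OF \<eta> dU dU'[folded \<eta>_sq] decay]) blast
  have ae: "AE x in lebesgue. u x $ i = soliton_num \<eta> a i x / soliton_den \<eta> a x" for i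
    using uU[of i] unfolding a .
  moreover have "u x $ i = soliton_num \<eta> a i x / soliton_den \<eta> a x"
    if "continuous_on UNIV (\<lambda>x. u x $ i)" for i x
    using AE_lebesgue_eq_continuous[OF ae that soliton_continuous[OF \<eta>]] .
  ultimately show ?thesis
    by blast
qed

end
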